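(* For all $n$ the cones $\mathcal{P}_{n,4}^{\mathfrak{S}_n}$, $\mathcal{P}_{n,6}^{B_n}$, $\mathcal{P}_{n,8}^{B_n}$ and $\mathcal{P}_{n,10}^{B_n}$ are spectrahedral shadows. Moreover, for forms in any of these families there exists a linear matrix inequality (LMI) of size $O(n^3)$ certifying the non-negativity.
   Context: $\mathfrak{S}_n$ acts on $\mathbb{R}^n$ by permuting coordinates; $B_n$ is the group of all coordinate permutations and sign changes on $\mathbb{R}^n$. For $G$ one of these groups, $\mathcal{P}_{n,2d}^G$ is the cone of $G$-invariant real forms of degree $2d$ in $n$ variables that are non-negative on $\mathbb{R}^n$. A linear matrix inequality (LMI) is an inequality $A_0+x_1A_1+\cdots+x_mA_m\succeq0$ with real symmetric matrices $A_0,\ldots,A_m$ of the same size and real unknowns $x_1,\ldots,x_m$; its size is the size of these matrices. A spectrahedron is the solution set of an LMI, and a spectrahedral shadow is the image of a spectrahedron under a linear projection. An LMI associated with a form $f$ certifies the non-negativity of $f$ if the LMI has a solution if and only if $f$ is non-negative. *)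

theory Defs
  imports
    "HOL-Combinatorics.Permutations"
    "HOL-Library.Landau_Symbols"
    "HOL-Library.Poly_Mapping"
    "Jordan_Normal_Form.Matrix"
begin

text \<open>
  Real polynomials are finitely supported maps from exponents to coefficients, with the ring
  structure of \<^theory>\<open>HOL-Library.Poly_Mapping\<close>. Variables are indexed by natural numbers;
  a polynomial in n variables only uses the indices below n. The space of points is
  \<open>carrier_vec n\<close>.
\<close>

type_synonym real_mpoly = "(nat \<Rightarrow>\<^sub>0 nat) \<Rightarrow>\<^sub>0 real"

definition poly_eval :: "real_mpoly \<Rightarrow> real vec \<Rightarrow> real" where
  "poly_eval f x =
     (\<Sum>\<alpha>\<in>Poly_Mapping.keys f.
        Poly_Mapping.lookup f \<alpha> * (\<Prod>i\<in>Poly_Mapping.keys \<alpha>. (x $ i) ^ Poly_Mapping.lookup \<alpha> i))"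

definition poly_scale :: "real \<Rightarrow> real_mpoly \<Rightarrow> real_mpoly" where
  "poly_scale c f = Poly_Mapping.map (\<lambda>a. c * a) f"

text \<open>Forms include the zero polynomial in every degree.\<close>

definition forms :: "nat \<Rightarrow> nat \<Rightarrow> real_mpoly set" where
  "forms n d =
     {f. \<forall>\<alpha>\<in>Poly_Mapping.keys f. Poly_Mapping.keys \<alpha> \<subseteq> {..<n} \<and>
        (\<Sum>i\<in>Poly_Mapping.keys \<alpha>. Poly_Mapping.lookup \<alpha> i) = d}"

text \<open>The groups are given by their actions, as sets of transformations of \<open>carrier_vec n\<close>.\<close>

definition coord_perms :: "nat \<Rightarrow> (real vec \<Rightarrow> real vec) set" where
  "coord_perms n = {(\<lambda>x. vec n (\<lambda>i. x $ \<sigma> i)) | \<sigma>. \<sigma> permutes {..<n}}"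

definition signed_coord_perms :: "nat \<Rightarrow> (real vec \<Rightarrow> real vec) set" where
  "signed_coord_perms n =
     {(\<lambda>x. vec n (\<lambda>i. \<epsilon> i * x $ \<sigma> i)) | \<epsilon> \<sigma>.
        \<sigma> permutes {..<n} \<and> (\<forall>i<n. \<epsilon> i = 1 \<or> \<epsilon> i = -1)}"

definition invariant_forms ::
    "(real vec \<Rightarrow> real vec) set \<Rightarrow> nat \<Rightarrow> nat \<Rightarrow> real_mpoly set" where
  "invariant_forms G n d =
     {f \<in> forms n d. \<forall>g\<in>G. \<forall>x\<in>carrier_vec n. poly_eval f (g x) = poly_eval f x}"

definition nonneg_poly :: "nat \<Rightarrow> real_mpoly \<Rightarrow> bool" where
  "nonneg_poly n f \<longleftrightarrow> (\<forall>x\<in>carrier_vec n. 0 \<le> poly_eval f x)"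

text \<open>Here \<open>d\<close> is the full degree of the forms.\<close>

definition nonneg_cone ::
    "(real vec \<Rightarrow> real vec) set \<Rightarrow> nat \<Rightarrow> nat \<Rightarrow> real_mpoly set" where
  "nonneg_cone G n d = {f \<in> invariant_forms G n d. nonneg_poly n f}"

definition sym_mats :: "nat \<Rightarrow> real mat set" where
  "sym_mats k = {M \<in> carrier_mat k k. transpose_mat M = M}"

definition psd :: "nat \<Rightarrow> real mat \<Rightarrow> bool" where
  "psd k M \<longleftrightarrow>
     M \<in> sym_mats k \<and> (\<forall>v\<in>carrier_vec k. 0 \<le> v \<bullet> (M *\<^sub>v v))"

text \<open>
  A linear matrix inequality of size \<open>k\<close> in \<open>m\<close> unknowns is given by its constant matrix \<open>A0\<close>
  and its coefficient matrices \<open>A 0, \<dots>, A (m - 1)\<close>; unknowns are numbered from 0.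
\<close>

definition is_lmi :: "nat \<Rightarrow> nat \<Rightarrow> real mat \<Rightarrow> (nat \<Rightarrow> real mat) \<Rightarrow> bool" where
  "is_lmi k m A0 A \<longleftrightarrow> A0 \<in> sym_mats k \<and> (\<forall>j<m. A j \<in> sym_mats k)"

text \<open>Matrices of varying size form no additive monoid type, so the sum is taken entrywise.\<close>

definition lmi_matrix ::
    "nat \<Rightarrow> nat \<Rightarrow> real mat \<Rightarrow> (nat \<Rightarrow> real mat) \<Rightarrow> real vec \<Rightarrow> real mat" where
  "lmi_matrix k m A0 A x =
     mat k k (\<lambda>(r, c). A0 $$ (r, c) + (\<Sum>j<m. x $ j * A j $$ (r, c)))"

definition lmi_solutions ::
    "nat \<Rightarrow> nat \<Rightarrow> real mat \<Rightarrow> (nat \<Rightarrow> real mat) \<Rightarrow> real vec set" where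
  "lmi_solutions k m A0 A = {x \<in> carrier_vec m. psd k (lmi_matrix k m A0 A x)}"

definition spectrahedron :: "nat \<Rightarrow> real vec set \<Rightarrow> bool" where
  "spectrahedron m S \<longleftrightarrow> (\<exists>k A0 A. is_lmi k m A0 A \<and> S = lmi_solutions k m A0 A)"

definition linear_to_polys :: "nat \<Rightarrow> (real vec \<Rightarrow> real_mpoly) \<Rightarrow> bool" where
  "linear_to_polys m \<pi> \<longleftrightarrow>
     (\<forall>x\<in>carrier_vec m. \<forall>y\<in>carrier_vec m. \<pi> (x + y) = \<pi> x + \<pi> y) \<and>
     (\<forall>c. \<forall>x\<in>carrier_vec m. \<pi> (c \<cdot>\<^sub>v x) = poly_scale c (\<pi> x))"

definition spectrahedral_shadow :: "real_mpoly set \<Rightarrow> bool" where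
  "spectrahedral_shadow C \<longleftrightarrow>
     (\<exists>m S \<pi>. spectrahedron m S \<and> linear_to_polys m \<pi> \<and> C = \<pi> ` S)"

text \<open>The LMI \<open>(A0, A)\<close> certifies the non-negativity of \<open>f\<close>.\<close>

definition certifies_nonneg ::
    "nat \<Rightarrow> nat \<Rightarrow> real mat \<Rightarrow> (nat \<Rightarrow> real mat) \<Rightarrow> nat \<Rightarrow> real_mpoly \<Rightarrow> bool" where
  "certifies_nonneg k m A0 A n f \<longleftrightarrow>
     is_lmi k m A0 A \<and> (lmi_solutions k m A0 A \<noteq> {} \<longleftrightarrow> nonneg_poly n f)"

text \<open>
  If for each single form one could choose an unrelated LMI, a certificate of size 1 would always
  exist (a solvable or an unsolvable one). An LMI associated with a form is therefore obtained from
  data not depending on the form: the coefficients of \<open>f\<close> enter affinely in the constant matrix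
  \<open>M0 + (\<Sum>\<alpha>. lookup f \<alpha> * M \<alpha>)\<close>, and the coefficient matrices of the unknowns are fixed. So the
  inequality is an LMI in the coefficients of \<open>f\<close> and the unknowns jointly.
\<close>

definition form_matrix ::
    "nat \<Rightarrow> real mat \<Rightarrow> ((nat \<Rightarrow>\<^sub>0 nat) \<Rightarrow> real mat) \<Rightarrow> real_mpoly \<Rightarrow> real mat" where
  "form_matrix k M0 M f =
     mat k k (\<lambda>(r, c). M0 $$ (r, c) +
       (\<Sum>\<alpha>\<in>Poly_Mapping.keys f. Poly_Mapping.lookup f \<alpha> * M \<alpha> $$ (r, c)))"

definition lmi_certifiable :: "nat \<Rightarrow> nat \<Rightarrow> real_mpoly set \<Rightarrow> bool" where
  "lmi_certifiable k n V \<longleftrightarrow>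
     (\<exists>m M0 M B. M0 \<in> sym_mats k \<and> (\<forall>\<alpha>. M \<alpha> \<in> sym_mats k) \<and>
        (\<forall>f\<in>V. certifies_nonneg k m (form_matrix k M0 M f) B n f))"

end

theory Submission
  imports Defs "Jordan_Normal_Form.Char_Poly" "HOL-Analysis.Function_Topology"
begin

text \<open>
  Degree principle: if all coordinates but three are fixed, an invariant form of the given degree is
  affine in \<open>e\<^sub>3\<close> of the three remaining coordinates (or of their squares for \<open>B\<^sub>n\<close>)
  once \<open>e\<^sub>1\<close> and \<open>e\<^sub>2\<close> are fixed, because \<open>e\<^sub>3\<close> squared has degree 6. Among the minimisers on
  the unit sphere choose one that maximises the sum of the cubes (of the sixth powers for \<open>B\<^sub>n\<close>).
  If it had three distinct values (three distinct nonzero absolute values), moving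
  \<open>e\<^sub>3\<close> slightly in both directions would keep the form minimal and increase that sum
  in one direction. So nonnegativity only has to be tested at the points
  \<open>(x, \<dots>, x, y, \<dots>, y, 0, \<dots>, 0)\<close>. For each of the \<open>O(n\<^sup>2)\<close> patterns this is the
  nonnegativity of a binary form, which is a sum of squares, so a Gram matrix of bounded size
  certifies it.
\<close>

section \<open>Nonnegative univariate polynomials\<close>

text \<open>Three points shape the argument. First, why cubes: for three numbers with
  \<open>e1\<close> and \<open>e2\<close> fixed, the sum of cubes is a constant plus 3
  \<open>e3\<close>, so the secondary objective measures exactly the parameter that moves. The sum
  of squares stays fixed as well, being \<open>e1\<close>^2 - 2 \<open>e2\<close>, or
  \<open>e1\<close> itself when the three numbers are squares, so the move remains on the sphere.
  Second, why three distinct values, nonzero for B_n: the three numbers are the roots of a monic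
  cubic, and moving \<open>e3\<close> shifts its constant term. Simple real roots survive a small
  shift in both directions, a multiple root need not. For B_n the roots must also remain positive to
  be squares again, so a vanishing coordinate cannot be moved; hence the block of zeros in the test
  points. Third, an LMI offers no linear equations, whereas a Gram matrix has to match the
  coefficients of the form. These equations are solved in advance by a linear parametrisation. The
  result is (n+1)^2 diagonal blocks of size D+1 for degree 2D, which is even quadratic in n.\<close>

lemma poly_nonneg_right_limit:
  fixes p :: "real poly"
  assumes "\<And>x. x > a \<Longrightarrow> 0 \<le> poly p x"
  shows "0 \<le> poly p a"
proof (rule tendsto_lowerbound)
  show "(poly p \<longlongrightarrow> poly p a) (at_right a)"
    by (intro tendsto_intros)
  show "eventually (\<lambda>x. 0 \<le> poly p x) (at_right a)"
    using assms by (auto simp: eventually_at_filter)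
qed simp

lemma poly_nonneg_left_limit:
  fixes p :: "real poly"
  assumes "\<And>x. x < a \<Longrightarrow> 0 \<le> poly p x"
  shows "0 \<le> poly p a"
proof (rule tendsto_lowerbound)
  show "(poly p \<longlongrightarrow> poly p a) (at_left a)"
    by (intro tendsto_intros)
  show "eventually (\<lambda>x. 0 \<le> poly p x) (at_left a)"
    using assms by (auto simp: eventually_at_filter)
qed simp

text \<open>Induction on the degree. For a complex root z the real quadratic with roots z and its
  conjugate is a sum of two squares, the cofactor is again nonnegative, and sums of two squares are
  closed under multiplication.\<close>

lemma nonneg_poly_two_squares:
  fixes p :: "real poly"
  assumes "\<And>x. 0 \<le> poly p x"
  shows "\<exists>q r. p = q * q + r * r"
  using assms
proof (induction "degree p" arbitrary: p rule: less_induct)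
  case less
  show ?case
  proof (cases "degree p = 0")
    case True
    then obtain c where c: "p = [:c:]" by (rule degree_eq_zeroE)
    then have "c \<ge> 0" using less.prems[of 0] by simp
    then have "p = [:sqrt c:] * [:sqrt c:] + 0 * 0" by (simp add: c)
    then show ?thesis by blast
  next
    case False
    then have "degree (map_poly complex_of_real p) \<noteq> 0" by (simp add: degree_map_poly)
    then have "\<not> constant (poly (map_poly complex_of_real p))" by (simp add: constant_degree)
    then obtain z where z: "poly (map_poly complex_of_real p) z = 0"
      using fundamental_theorem_of_algebra by blast
    define a b where "a = Re z" and "b = Im z"
    define c :: "real poly" where "c = [:a\<^sup>2 + b\<^sup>2, - 2 * a, 1:]"
    have c_pos: "0 \<le> poly c x" "x \<noteq> a \<Longrightarrow> 0 < poly c x" for x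
    proof -
      have eq: "poly c x = (x - a)\<^sup>2 + b\<^sup>2"
        by (simp add: c_def algebra_simps power2_eq_square)
      show "0 \<le> poly c x" by (simp add: eq)
      show "0 < poly c x" if "x \<noteq> a" using that by (simp add: eq add_pos_nonneg)
    qed
    have dc: "degree c = 2" by (simp add: c_def)
    have "c dvd p"
    proof (cases "b = 0")
      case True
      then have "z = complex_of_real a" by (simp add: a_def b_def complex_eq_iff)
      then have "poly p a = 0" using z by (metis of_real_eq_0_iff of_real_hom.poly_map_poly)
      then obtain p1 where p1: "p = [:-a, 1:] * p1" by (metis dvdE poly_eq_0_iff_dvd)
      have "0 \<le> poly p1 x" if "x > a" for x
        using less.prems[of x] that
        by (auto simp: p1 zero_le_mult_iff simp flip: left_diff_distrib)
      moreover have "0 \<le> poly (- p1) x" if "x < a" for x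
        using less.prems[of x] that
        by (auto simp: p1 zero_le_mult_iff simp flip: left_diff_distrib)
      \<comment> \<open>A nonnegative polynomial cannot change sign at a real root, so the root is
        at least double.\<close>
      ultimately have "poly p1 a = 0"
        using poly_nonneg_right_limit[of a p1] poly_nonneg_left_limit[of a "- p1"] by simp
      then obtain p2 where p2: "p1 = [:-a, 1:] * p2" by (metis dvdE poly_eq_0_iff_dvd)
      then have "poly p = poly (c * p2)"
        unfolding p1 p2 by (auto simp: c_def True power2_eq_square algebra_simps)
      then have "p = c * p2" by (simp only: poly_eq_poly_eq_iff)
      then show ?thesis by simp
    next
      case False
      interpret of_real_poly: map_poly_comm_ring_hom complex_of_real ..
      define r where "r = p mod c"
      have c0: "c \<noteq> 0" using dc by auto
      have "degree r < 2" unfolding r_def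
        using degree_mod_less[OF c0, of p] dc by auto
      then have "r = [:coeff r 0, coeff r 1:]"
        by (intro poly_eqI) (auto simp: coeff_pCons coeff_eq_0 split: nat.split)
      then obtain u v where r: "r = [:u, v:]" by blast
      have "p = c * (p div c) + r" by (simp add: r_def)
      then have "poly (map_poly complex_of_real p) z =
          poly (map_poly complex_of_real c) z * poly (map_poly complex_of_real (p div c)) z
          + poly (map_poly complex_of_real r) z"
        by (metis of_real_hom.map_poly_hom_add of_real_poly.hom_mult poly_add poly_mult)
      moreover have "poly (map_poly complex_of_real c) z = 0"
        by (simp add: c_def map_poly_pCons a_def b_def complex_eq_iff power2_eq_square algebra_simps)
      ultimately have "poly (map_poly complex_of_real r) z = 0" using z by simp
      then have "complex_of_real u + z * complex_of_real v = 0"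
        by (simp add: r of_real_hom.map_poly_pCons_hom)
      \<comment> \<open>Imaginary and real part of u + v z = 0. As b is nonzero, v vanishes first
        and then u.\<close>
      then have "v * b = 0 \<and> u + a * v = 0"
        by (auto simp: complex_eq_iff a_def b_def)
      then have "r = 0" using False by (auto simp: r)
      then show ?thesis by (simp add: r_def mod_eq_0_iff_dvd)
    qed
    then obtain p2 where p2: "p = c * p2" by blast
    have "p \<noteq> 0" using False by auto
    then have "degree p2 < degree p" by (simp add: p2 degree_mult_eq dc)
    moreover have "0 \<le> poly p2 x" if "x > a" for x
      using less.prems[of x] c_pos(2)[of x] that by (simp add: p2 zero_le_mult_iff)
    moreover have "0 \<le> poly p2 x" if "x < a" for x
      using less.prems[of x] c_pos(2)[of x] that by (simp add: p2 zero_le_mult_iff)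
    \<comment> \<open>At x = a the factor \<open>c\<close> may vanish, so the sign of
      \<open>p2\<close> there comes from a limit.\<close>
    ultimately have "0 \<le> poly p2 x" for x
      using poly_nonneg_right_limit[of a p2] by (cases x a rule: linorder_cases) auto
    with \<open>degree p2 < degree p\<close> have "\<exists>q r. p2 = q * q + r * r" by (rule less.hyps)
    then obtain q r where "p2 = q * q + r * r" by blast
    \<comment> \<open>Brahmagupta-Fibonacci identity for ((x - a)^2 + b^2)(q^2 + r^2).\<close>
    then have "poly p = poly (([:-a, 1:] * q - [:b:] * r) * ([:-a, 1:] * q - [:b:] * r)
        + ([:-a, 1:] * r + [:b:] * q) * ([:-a, 1:] * r + [:b:] * q))"
      by (auto simp: p2 c_def algebra_simps power2_eq_square)
    then have "p = ([:-a, 1:] * q - [:b:] * r) * ([:-a, 1:] * q - [:b:] * r)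
        + ([:-a, 1:] * r + [:b:] * q) * ([:-a, 1:] * r + [:b:] * q)"
      by (simp only: poly_eq_poly_eq_iff)
    then show ?thesis by blast
  qed
qed

section \<open>Symmetric functions of three variables\<close>

text \<open>\<open>A\<close> and \<open>B\<close> may be arbitrary functions: the perturbation keeps
  their two arguments constant, so only one value of each ever matters.\<close>

definition affine_in_e3 :: "(real \<Rightarrow> real \<Rightarrow> real \<Rightarrow> real) \<Rightarrow> bool" where
  "affine_in_e3 \<phi> \<longleftrightarrow> (\<exists>A B. \<forall>u v w. \<phi> u v w =
     A (u + v + w) (u * v + u * w + v * w) + B (u + v + w) (u * v + u * w + v * w) * (u * v * w))"

definition depends_on_e1_e2 :: "(real \<Rightarrow> real \<Rightarrow> real \<Rightarrow> real) \<Rightarrow> bool" where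
  "depends_on_e1_e2 \<phi> \<longleftrightarrow> (\<exists>A. \<forall>u v w. \<phi> u v w = A (u + v + w) (u * v + u * w + v * w))"

lemma depends_imp_affine: "depends_on_e1_e2 \<phi> \<Longrightarrow> affine_in_e3 \<phi>"
proof -
  assume "depends_on_e1_e2 \<phi>"
  then obtain A where "\<And>u v w. \<phi> u v w = A (u + v + w) (u * v + u * w + v * w)"
    by (auto simp: depends_on_e1_e2_def)
  then show ?thesis
    unfolding affine_in_e3_def by (intro exI[of _ A] exI[of _ "\<lambda>_ _. 0"]) simp
qed

lemma affine_in_e3_add:
  assumes "affine_in_e3 \<phi>" "affine_in_e3 \<psi>"
  shows "affine_in_e3 (\<lambda>u v w. \<phi> u v w + \<psi> u v w)"
proof -
  obtain A B where 1: "\<And>u v w. \<phi> u v w = A (u + v + w) (u * v + u * w + v * w) +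
      B (u + v + w) (u * v + u * w + v * w) * (u * v * w)"
    using assms(1) by (auto simp: affine_in_e3_def)
  obtain A' B' where 2: "\<And>u v w. \<psi> u v w = A' (u + v + w) (u * v + u * w + v * w) +
      B' (u + v + w) (u * v + u * w + v * w) * (u * v * w)"
    using assms(2) by (auto simp: affine_in_e3_def)
  show ?thesis
    unfolding affine_in_e3_def
    by (rule exI[of _ "\<lambda>s t. A s t + A' s t"], rule exI[of _ "\<lambda>s t. B s t + B' s t"])
      (simp add: 1 2 algebra_simps)
qed

lemma affine_in_e3_mult:
  assumes "depends_on_e1_e2 \<phi>" "affine_in_e3 \<psi>"
  shows "affine_in_e3 (\<lambda>u v w. \<phi> u v w * \<psi> u v w)"
proof -
  obtain A where 1: "\<And>u v w. \<phi> u v w = A (u + v + w) (u * v + u * w + v * w)"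
    using assms(1) by (auto simp: depends_on_e1_e2_def)
  obtain A' B' where 2: "\<And>u v w. \<psi> u v w = A' (u + v + w) (u * v + u * w + v * w) +
      B' (u + v + w) (u * v + u * w + v * w) * (u * v * w)"
    using assms(2) by (auto simp: affine_in_e3_def)
  show ?thesis
    unfolding affine_in_e3_def
    by (rule exI[of _ "\<lambda>s t. A s t * A' s t"], rule exI[of _ "\<lambda>s t. A s t * B' s t"])
      (simp add: 1 2 algebra_simps)
qed

lemma depends_on_e1_e2_const: "depends_on_e1_e2 (\<lambda>_ _ _. c)"
  by (auto simp: depends_on_e1_e2_def)

lemma depends_on_e1_e2_mult:
  assumes "depends_on_e1_e2 \<phi>" "depends_on_e1_e2 \<psi>"
  shows "depends_on_e1_e2 (\<lambda>u v w. \<phi> u v w * \<psi> u v w)"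
proof -
  obtain A A' where "\<And>u v w. \<phi> u v w = A (u + v + w) (u * v + u * w + v * w)"
    "\<And>u v w. \<psi> u v w = A' (u + v + w) (u * v + u * w + v * w)"
    using assms by (auto simp: depends_on_e1_e2_def)
  then show ?thesis
    unfolding depends_on_e1_e2_def by (intro exI[of _ "\<lambda>s t. A s t * A' s t"]) simp
qed

lemma affine_in_e3_scale:
  "affine_in_e3 \<phi> \<Longrightarrow> affine_in_e3 (\<lambda>u v w. c * \<phi> u v w)"
  by (rule affine_in_e3_mult[OF depends_on_e1_e2_const])

lemma affine_in_e3_sum:
  assumes "\<And>i. i \<in> I \<Longrightarrow> affine_in_e3 (\<phi> i)"
  shows "affine_in_e3 (\<lambda>u v w. \<Sum>i\<in>I. \<phi> i u v w)"
  using assms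
  by (induction I rule: infinite_finite_induct)
    (auto intro: affine_in_e3_add depends_imp_affine depends_on_e1_e2_const)

definition power_sum3 :: "nat \<Rightarrow> real \<Rightarrow> real \<Rightarrow> real \<Rightarrow> real" where
  "power_sum3 k u v w = u ^ k + v ^ k + w ^ k"

text \<open>Newton's recursion: u, v, w are the roots of t^3 - e1 t^2 + e2 t - e3.\<close>

lemma power_sum3_rec:
  "power_sum3 (Suc (Suc (Suc k))) u v w =
     (u + v + w) * power_sum3 (Suc (Suc k)) u v w
     - (u * v + u * w + v * w) * power_sum3 (Suc k) u v w + (u * v * w) * power_sum3 k u v w"
  by (simp add: power_sum3_def algebra_simps)

lemma power_sum3_depends:
  assumes "k \<le> 2"
  shows "depends_on_e1_e2 (power_sum3 k)"
proof -
  consider "k = 0" | "k = 1" | "k = 2" using assms by linarith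
  then show ?thesis
  proof cases
    case 1
    then show ?thesis unfolding depends_on_e1_e2_def power_sum3_def
      by (intro exI[of _ "\<lambda>s t. 3"]) simp
  next
    case 2
    then show ?thesis unfolding depends_on_e1_e2_def power_sum3_def
      by (intro exI[of _ "\<lambda>s t. s"]) simp
  next
    case 3
    then show ?thesis unfolding depends_on_e1_e2_def power_sum3_def
      by (intro exI[of _ "\<lambda>s t. s * s - 2 * t"]) (simp add: algebra_simps power2_eq_square)
  qed
qed

text \<open>The recursion multiplies e3 by the power sum of index k - 3, which for k at most 5
  depends on e1 and e2 only. At k = 6 the square of e3 appears.\<close>

lemma power_sum3_affine:
  assumes "k \<le> 5"
  shows "affine_in_e3 (power_sum3 k)"
  using assms
proof (induction k rule: less_induct)
  case (less k)
  show ?case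
  proof (cases "k \<le> 2")
    case True
    then show ?thesis by (intro depends_imp_affine power_sum3_depends)
  next
    case False
    then have "k = Suc (Suc (Suc (k - 3)))" "k - 3 \<le> 2"
      using less.prems by auto
    then obtain j where k: "k = Suc (Suc (Suc j))" "j \<le> 2" by blast
    have e1: "depends_on_e1_e2 (\<lambda>u v w. u + v + w)"
      unfolding depends_on_e1_e2_def by (intro exI[of _ "\<lambda>s t. s"]) simp
    have e2: "depends_on_e1_e2 (\<lambda>u v w. - (u * v + u * w + v * w))"
      unfolding depends_on_e1_e2_def by (intro exI[of _ "\<lambda>s t. - t"]) simp
    have e3: "affine_in_e3 (\<lambda>u v w. u * v * w)"
      unfolding affine_in_e3_def by (intro exI[of _ "\<lambda>s t. 0"] exI[of _ "\<lambda>s t. 1"]) simp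
    have "affine_in_e3 (\<lambda>u v w. ((u + v + w) * power_sum3 (Suc (Suc j)) u v w
        + (- (u * v + u * w + v * w)) * power_sum3 (Suc j) u v w)
        + power_sum3 j u v w * (u * v * w))"
      using less k(2) unfolding k(1)
      by (intro affine_in_e3_add affine_in_e3_mult e1 e2 e3 power_sum3_depends) auto
    also have "(\<lambda>u v w. ((u + v + w) * power_sum3 (Suc (Suc j)) u v w
        + (- (u * v + u * w + v * w)) * power_sum3 (Suc j) u v w)
        + power_sum3 j u v w * (u * v * w)) = power_sum3 k"
      by (intro ext) (simp add: k(1) power_sum3_rec algebra_simps)
    finally show ?thesis .
  qed
qed

text \<open>All six assignments are kept even when exponents coincide, so that one identity in power
  sums covers every case.\<close>

definition sym_monom3 :: "nat \<Rightarrow> nat \<Rightarrow> nat \<Rightarrow> real \<Rightarrow> real \<Rightarrow> real \<Rightarrow> real" where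
  "sym_monom3 a b c u v w =
     u ^ a * v ^ b * w ^ c + u ^ a * w ^ b * v ^ c + v ^ a * u ^ b * w ^ c
     + v ^ a * w ^ b * u ^ c + w ^ a * u ^ b * v ^ c + w ^ a * v ^ b * u ^ c"

lemma affine_power_sum3_mult:
  assumes "a + b \<le> 5"
  shows "affine_in_e3 (\<lambda>u v w. power_sum3 a u v w * power_sum3 b u v w)"
proof (cases "a \<le> 2")
  case True
  then show ?thesis
    using assms by (intro affine_in_e3_mult power_sum3_depends power_sum3_affine) auto
next
  case False
  then have "affine_in_e3 (\<lambda>u v w. power_sum3 b u v w * power_sum3 a u v w)"
    using assms by (intro affine_in_e3_mult power_sum3_depends power_sum3_affine) auto
  then show ?thesis by (simp add: mult.commute)
qed

text \<open>
  Among the indices of the occurring products of power sums at most one exceeds 2, and the power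
  sums of index at most 2 depend on the first two elementary symmetric functions only.
\<close>

lemma sym_monom3_affine:
  assumes "a + b + c \<le> 5"
  shows "affine_in_e3 (sym_monom3 a b c)"
proof -
  let ?p = power_sum3
  have triple: "affine_in_e3 (\<lambda>u v w. ?p a u v w * (?p b u v w * ?p c u v w))"
  proof (cases "a \<le> 2")
    case True
    then show ?thesis
      using assms by (intro affine_in_e3_mult power_sum3_depends affine_power_sum3_mult) auto
  next
    case False
    then have "affine_in_e3 (\<lambda>u v w. (?p b u v w * ?p c u v w) * ?p a u v w)"
      using assms
      by (intro affine_in_e3_mult depends_on_e1_e2_mult power_sum3_depends power_sum3_affine) auto
    then show ?thesis by (simp add: ac_simps)
  qed
  \<comment> \<open>Inclusion-exclusion: the product of three power sums also contains the terms in
    which variables coincide. Subtracting the three pairwise coincidences removes the triple one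
    three times, hence the correction by 2.\<close>
  have "affine_in_e3 (\<lambda>u v w. ?p a u v w * (?p b u v w * ?p c u v w)
      + (-1) * (?p (a + b) u v w * ?p c u v w) + (-1) * (?p (a + c) u v w * ?p b u v w)
      + (-1) * (?p (b + c) u v w * ?p a u v w) + 2 * ?p (a + b + c) u v w)"
    using assms
    by (intro affine_in_e3_add affine_in_e3_scale triple affine_power_sum3_mult power_sum3_affine)
      auto
  also have "(\<lambda>u v w. ?p a u v w * (?p b u v w * ?p c u v w)
      + (-1) * (?p (a + b) u v w * ?p c u v w) + (-1) * (?p (a + c) u v w * ?p b u v w)
      + (-1) * (?p (b + c) u v w * ?p a u v w) + 2 * ?p (a + b + c) u v w) = sym_monom3 a b c"
    by (intro ext) (simp add: power_sum3_def sym_monom3_def power_add algebra_simps)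
  finally show ?thesis .
qed

text \<open>Vieta's formulas for the cubic (t - x)(t - y)(t - z) - s with the distinct roots U, V,
  W.\<close>

lemma cubic_shift_roots:
  fixes x y z s U V W :: real
  assumes "(U - x) * (U - y) * (U - z) = s" "(V - x) * (V - y) * (V - z) = s"
    "(W - x) * (W - y) * (W - z) = s" "U < V" "V < W"
  shows "U + V + W = x + y + z" "U * V + U * W + V * W = x * y + x * z + y * z"
    "U * V * W = x * y * z + s"
proof -
  let ?e1 = "x + y + z" and ?e2 = "x * y + x * z + y * z" and ?e3 = "x * y * z + s"
  have U: "U ^ 3 - ?e1 * U ^ 2 + ?e2 * U - ?e3 = 0"
    using assms(1) by (simp add: algebra_simps power2_eq_square power3_eq_cube)
  have V: "V ^ 3 - ?e1 * V ^ 2 + ?e2 * V - ?e3 = 0"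
    using assms(2) by (simp add: algebra_simps power2_eq_square power3_eq_cube)
  have W: "W ^ 3 - ?e1 * W ^ 2 + ?e2 * W - ?e3 = 0"
    using assms(3) by (simp add: algebra_simps power2_eq_square power3_eq_cube)
  \<comment> \<open>Divided differences: each subtraction contains the difference of two roots as a
    factor, which cancels and lowers the degree until only e1 is left.\<close>
  have "(U - V) * (U ^ 2 + U * V + V ^ 2 - ?e1 * (U + V) + ?e2) = 0"
    using U V by (simp add: algebra_simps power2_eq_square power3_eq_cube)
  then have UV: "U ^ 2 + U * V + V ^ 2 - ?e1 * (U + V) + ?e2 = 0" using assms(4) by simp
  have "(V - W) * (V ^ 2 + V * W + W ^ 2 - ?e1 * (V + W) + ?e2) = 0"
    using V W by (simp add: algebra_simps power2_eq_square power3_eq_cube)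
  then have VW: "V ^ 2 + V * W + W ^ 2 - ?e1 * (V + W) + ?e2 = 0" using assms(5) by simp
  have "(U - W) * (U + V + W - ?e1) = 0"
    using UV VW by (simp add: algebra_simps power2_eq_square)
  then show e1: "U + V + W = ?e1" using assms(4,5) by simp
  show e2: "U * V + U * W + V * W = ?e2"
    using UV unfolding e1[symmetric] by (simp add: algebra_simps power2_eq_square)
  show "U * V * W = ?e3"
    using U unfolding e1[symmetric] e2[symmetric]
    by (simp add: algebra_simps power2_eq_square power3_eq_cube)
qed

text \<open>Adding s to e3 while keeping e1 and e2 means solving \<open>q t = s\<close> instead of
  \<open>q t = 0\<close>. Simple roots are sign changes, and these persist for small s of either
  sign.\<close>

lemma cubic_perturb:
  fixes x y z :: real
  assumes "x < y" "y < z" "l < x"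
  obtains \<epsilon> where "\<epsilon> > 0" "\<And>s. \<bar>s\<bar> \<le> \<epsilon> \<Longrightarrow> \<exists>U V W. l < U \<and> l < V \<and> l < W \<and>
    U + V + W = x + y + z \<and> U * V + U * W + V * W = x * y + x * z + y * z \<and>
    U * V * W = x * y * z + s"
proof -
  define q where "q t = (t - x) * (t - y) * (t - z)" for t
  \<comment> \<open>Separators between which \<open>q\<close> changes sign. Placing
    \<open>t0\<close> above \<open>l\<close> keeps all new roots above \<open>l\<close>.\<close>
  define t0 t1 t2 t3 where
    "t0 = (l + x) / 2" and "t1 = (x + y) / 2" and "t2 = (y + z) / 2" and "t3 = z + 1"
  \<comment> \<open>Half the least absolute value of \<open>q\<close> at the separators. The strict
    gap keeps the new roots off the shared interval ends, so they are distinct.\<close>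
  define \<epsilon> where "\<epsilon> = min (min (- q t0) (q t1)) (min (- q t2) (q t3)) / 2"
  have t: "l < t0" "t0 < x" "x < t1" "t1 < y" "y < t2" "t2 < z" "z < t3"
    using assms by (simp_all add: t0_def t1_def t2_def t3_def)
  have "q t0 < 0" "q t1 > 0" "q t2 < 0" "q t3 > 0"
    using t by (auto simp: q_def mult_less_0_iff zero_less_mult_iff)
  then have e: "\<epsilon> > 0" "q t0 < - \<epsilon>" "\<epsilon> < q t1" "q t2 < - \<epsilon>" "\<epsilon> < q t3"
    by (simp_all add: \<epsilon>_def)
  have cont: "isCont q t" for t unfolding q_def by (intro continuous_intros)
  have "\<exists>U V W. l < U \<and> l < V \<and> l < W \<and>
    U + V + W = x + y + z \<and> U * V + U * W + V * W = x * y + x * z + y * z \<and>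
    U * V * W = x * y * z + s" if s: "\<bar>s\<bar> \<le> \<epsilon>" for s
  proof -
    obtain U where U: "t0 \<le> U" "U \<le> t1" "q U = s"
      using IVT[of q t0 s t1] cont e s t by force
    obtain V where V: "t1 \<le> V" "V \<le> t2" "q V = s"
      using IVT2[of q t2 s t1] cont e s t by force
    obtain W where W: "t2 \<le> W" "W \<le> t3" "q W = s"
      using IVT[of q t2 s t3] cont e s t by force
    have "U \<noteq> t1" "V \<noteq> t2" using U V W e s by auto
    then have "U < V" "V < W" using U V W by auto
    then show ?thesis
      using cubic_shift_roots[of U x y z s V W] U V W t by (intro exI[of _ U] exI[of _ V] exI[of _ W])
        (auto simp: q_def)
  qed
  then show ?thesis using that e(1) by blast
qed

section \<open>The degree principle\<close>

text \<open>Points are functions on all naturals with the product topology. Pinning the coordinates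
  from \<open>n\<close> on to 0 is what makes the set compact.\<close>

definition unit_sphere :: "nat \<Rightarrow> (nat \<Rightarrow> real) set" where
  "unit_sphere n = {x. (\<forall>i\<ge>n. x i = 0) \<and> (\<Sum>i<n. (x i)\<^sup>2) = 1}"

lemma continuous_on_coordinate [continuous_intros]:
  "continuous_on A (\<lambda>x :: nat \<Rightarrow> real. x i)"
  by (rule continuous_on_product_then_coordinatewise) (rule continuous_on_id)

text \<open>A closed subset of a product of intervals [-1, 1], which is compact by
  Tychonoff.\<close>

lemma compact_unit_sphere: "compact (unit_sphere n)"
proof -
  let ?box = "PiE (UNIV :: nat set) (\<lambda>_. {-1..1 :: real})"
  have "compactin (product_topology (\<lambda>i. euclidean) UNIV) ?box"
    by (simp add: compactin_PiE)
  then have "compact ?box" by (simp add: euclidean_product_topology)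
  moreover have "closed (unit_sphere n)"
    unfolding unit_sphere_def
    by (intro closed_Collect_conj closed_Collect_all closed_Collect_imp closed_Collect_eq
        continuous_intros) auto
  moreover have "unit_sphere n \<subseteq> ?box"
  proof
    fix x assume x: "x \<in> unit_sphere n"
    have "\<bar>x i\<bar> \<le> 1" for i
    proof (cases "i < n")
      case True
      then have "(x i)\<^sup>2 \<le> (\<Sum>i<n. (x i)\<^sup>2)" by (intro member_le_sum) auto
      then show ?thesis using x by (simp add: unit_sphere_def abs_le_square_iff[of _ 1, simplified])
    qed (use x in \<open>simp add: unit_sphere_def\<close>)
    then show "x \<in> ?box" by (auto simp: abs_le_iff minus_le_iff)
  qed
  ultimately show ?thesis by (metis compact_Int_closed inf.absorb_iff2)
qed

text \<open>The minimisers of \<open>g\<close> form a compact set, on which \<open>h\<close> attains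
  its maximum.\<close>

lemma extremal_minimiser:
  fixes g h :: "'a :: topological_space \<Rightarrow> real"
  assumes "compact K" "K \<noteq> {}" "continuous_on UNIV g" "continuous_on UNIV h"
  obtains z where "z \<in> K" "\<And>y. y \<in> K \<Longrightarrow> g z \<le> g y"
    "\<And>y. y \<in> K \<Longrightarrow> g y = g z \<Longrightarrow> h y \<le> h z"
proof -
  obtain z0 where z0: "z0 \<in> K" "\<And>y. y \<in> K \<Longrightarrow> g z0 \<le> g y"
    using continuous_attains_inf[OF assms(1,2)] assms(3) continuous_on_subset by blast
  have "closed {y. g y = g z0}"
    using assms(3) by (intro closed_Collect_eq continuous_intros)
  then have "compact (K \<inter> {y. g y = g z0})" using assms(1) by (rule compact_Int_closed[rotated])
  moreover have "K \<inter> {y. g y = g z0} \<noteq> {}" using z0 by auto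
  ultimately obtain z where "z \<in> K \<inter> {y. g y = g z0}" "\<And>y. y \<in> K \<inter> {y. g y = g z0} \<Longrightarrow> h y \<le> h z"
    using continuous_attains_sup[of "K \<inter> {y. g y = g z0}" h] assms(4) continuous_on_subset by blast
  then show ?thesis using that[of z] z0 by auto
qed

lemma sum_update3:
  fixes z :: "nat \<Rightarrow> real" and \<psi> :: "real \<Rightarrow> real"
  assumes "i < n" "j < n" "k < n" "i \<noteq> j" "i \<noteq> k" "j \<noteq> k"
  shows "(\<Sum>m<n. \<psi> ((z(i := u, j := v, k := w)) m)) =
    (\<Sum>m\<in>{..<n} - {i, j, k}. \<psi> (z m)) + (\<psi> u + \<psi> v + \<psi> w)"
proof -
  have "{..<n} = ({..<n} - {i, j, k}) \<union> {i, j, k}" using assms by auto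
  then have "(\<Sum>m<n. \<psi> ((z(i := u, j := v, k := w)) m)) =
    (\<Sum>m\<in>{..<n} - {i, j, k}. \<psi> ((z(i := u, j := v, k := w)) m))
    + (\<Sum>m\<in>{i, j, k}. \<psi> ((z(i := u, j := v, k := w)) m))"
    by (metis (no_types, lifting) Diff_disjoint finite.emptyI finite_Diff finite_insert finite_lessThan
        inf_commute sum.union_disjoint)
  also have "(\<Sum>m\<in>{..<n} - {i, j, k}. \<psi> ((z(i := u, j := v, k := w)) m)) =
      (\<Sum>m\<in>{..<n} - {i, j, k}. \<psi> (z m))"
    by (intro sum.cong) auto
  also have "(\<Sum>m\<in>{i, j, k}. \<psi> ((z(i := u, j := v, k := w)) m)) = \<psi> u + \<psi> v + \<psi> w"
    using assms by simp
  finally show ?thesis .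
qed

lemma prod_update3:
  fixes z :: "nat \<Rightarrow> real" and e :: "nat \<Rightarrow> nat"
  assumes "i < n" "j < n" "k < n" "i \<noteq> j" "i \<noteq> k" "j \<noteq> k"
  shows "(\<Prod>m<n. (z(i := u, j := v, k := w)) m ^ e m) =
    (\<Prod>m\<in>{..<n} - {i, j, k}. z m ^ e m) * (u ^ e i * v ^ e j * w ^ e k)"
proof -
  have "{..<n} = ({..<n} - {i, j, k}) \<union> {i, j, k}" using assms by auto
  then have "(\<Prod>m<n. (z(i := u, j := v, k := w)) m ^ e m) =
    (\<Prod>m\<in>{..<n} - {i, j, k}. (z(i := u, j := v, k := w)) m ^ e m)
    * (\<Prod>m\<in>{i, j, k}. (z(i := u, j := v, k := w)) m ^ e m)"
    by (metis (no_types, lifting) Diff_disjoint finite.emptyI finite_Diff finite_insert finite_lessThan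
        inf_commute prod.union_disjoint)
  also have "(\<Prod>m\<in>{..<n} - {i, j, k}. (z(i := u, j := v, k := w)) m ^ e m) =
      (\<Prod>m\<in>{..<n} - {i, j, k}. z m ^ e m)"
    by (intro prod.cong) auto
  also have "(\<Prod>m\<in>{i, j, k}. (z(i := u, j := v, k := w)) m ^ e m) = u ^ e i * v ^ e j * w ^ e k"
    using assms by simp
  finally show ?thesis .
qed

text \<open>Common core for both groups: \<open>q\<close> is the identity for coordinate
  permutations and squaring for B_n. The bound \<open>l\<close> says which values \<open>q\<close>
  can attain, and \<open>N\<close> expresses the sum of squares by e1 and e2, so that replacing
  three coordinates does not leave the sphere.\<close>

lemma extremal_not_three_values:
  fixes g :: "(nat \<Rightarrow> real) \<Rightarrow> real" and q :: "real \<Rightarrow> real"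
  assumes z: "z \<in> unit_sphere n"
    and min: "\<And>y. y \<in> unit_sphere n \<Longrightarrow> g z \<le> g y"
    and max: "\<And>y. y \<in> unit_sphere n \<Longrightarrow> g y = g z \<Longrightarrow>
      (\<Sum>m<n. q (y m) ^ 3) \<le> (\<Sum>m<n. q (z m) ^ 3)"
    and ijk: "i < n" "j < n" "k < n" "q (z i) < q (z j)" "q (z j) < q (z k)"
    and affine: "affine_in_e3 \<phi>"
      "\<And>u v w. g (z(i := u, j := v, k := w)) = \<phi> (q u) (q v) (q w)"
    and range: "l < q (z i)" "\<And>U. l < U \<Longrightarrow> \<exists>u. q u = U"
    and squares: "\<And>u v w. u\<^sup>2 + v\<^sup>2 + w\<^sup>2 =
      N (q u + q v + q w) (q u * q v + q u * q w + q v * q w)"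
  shows False
proof -
  have neq: "i \<noteq> j" "i \<noteq> k" "j \<noteq> k" using ijk by auto
  define s1 s2 s3 where "s1 = q (z i) + q (z j) + q (z k)"
    and "s2 = q (z i) * q (z j) + q (z i) * q (z k) + q (z j) * q (z k)"
    and "s3 = q (z i) * q (z j) * q (z k)"
  have z_eq: "z = z(i := z i, j := z j, k := z k)" by simp
  obtain A B where \<phi>: "\<And>u v w. \<phi> u v w = A (u + v + w) (u * v + u * w + v * w) +
      B (u + v + w) (u * v + u * w + v * w) * (u * v * w)"
    using affine(1) by (auto simp: affine_in_e3_def)
  have gz: "g z = A s1 s2 + B s1 s2 * s3"
    using affine(2)[of "z i" "z j" "z k"] by (simp add: \<phi> s1_def s2_def s3_def)
  obtain \<epsilon> where \<epsilon>: "\<epsilon> > 0" "\<And>s. \<bar>s\<bar> \<le> \<epsilon> \<Longrightarrow> \<exists>U V W. l < U \<and> l < V \<and> l < W \<and>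
    U + V + W = s1 \<and> U * V + U * W + V * W = s2 \<and> U * V * W = s3 + s"
    using cubic_perturb[OF ijk(4,5) range(1)] unfolding s1_def s2_def s3_def by metis
  have shift: "\<exists>y\<in>unit_sphere n. g y = g z + B s1 s2 * s \<and>
      (\<Sum>m<n. q (y m) ^ 3) = (\<Sum>m<n. q (z m) ^ 3) + 3 * s" if s: "\<bar>s\<bar> \<le> \<epsilon>" for s
  proof -
    obtain U V W where UVW: "l < U" "l < V" "l < W"
      "U + V + W = s1" "U * V + U * W + V * W = s2" "U * V * W = s3 + s"
      using \<epsilon>(2)[OF s] by blast
    obtain u v w where uvw: "q u = U" "q v = V" "q w = W" using range(2) UVW(1-3) by metis
    let ?y = "z(i := u, j := v, k := w)"
    note sums = sum_update3[OF ijk(1-3) neq]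
    have "u\<^sup>2 + v\<^sup>2 + w\<^sup>2 = (z i)\<^sup>2 + (z j)\<^sup>2 + (z k)\<^sup>2"
      unfolding squares using UVW uvw by (simp add: s1_def s2_def)
    then have "(\<Sum>m<n. (?y m)\<^sup>2) = (\<Sum>m<n. (z m)\<^sup>2)"
      using sums[of "\<lambda>t. t\<^sup>2" z u v w] sums[of "\<lambda>t. t\<^sup>2" z "z i" "z j" "z k"]
      by (simp only: z_eq[symmetric])
    then have "?y \<in> unit_sphere n" using z ijk(1-3) by (simp add: unit_sphere_def)
    moreover have "g ?y = g z + B s1 s2 * s"
      unfolding affine(2) \<phi> gz uvw UVW by (simp add: algebra_simps)
    moreover have "q u ^ 3 + q v ^ 3 + q w ^ 3 = q (z i) ^ 3 + q (z j) ^ 3 + q (z k) ^ 3 + 3 * s"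
    proof -
      \<comment> \<open>Newton's identity for the third power sum, the source of the term 3
        s.\<close>
      have cubes: "a ^ 3 + b ^ 3 + c ^ 3 =
        (a + b + c) ^ 3 - 3 * (a + b + c) * (a * b + a * c + b * c) + 3 * (a * b * c)" for a b c :: real
        by (simp add: algebra_simps power3_eq_cube)
      show ?thesis
        unfolding cubes uvw UVW unfolding s1_def[symmetric] s2_def[symmetric] s3_def[symmetric] by simp
    qed
    then have "(\<Sum>m<n. q (?y m) ^ 3) = (\<Sum>m<n. q (z m) ^ 3) + 3 * s"
      using sums[of "\<lambda>t. q t ^ 3" z u v w] sums[of "\<lambda>t. q t ^ 3" z "z i" "z j" "z k"]
      by (simp only: z_eq[symmetric])
    ultimately show ?thesis by blast
  qed
  obtain y1 where y1: "y1 \<in> unit_sphere n" "g y1 = g z + B s1 s2 * \<epsilon>"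
    "(\<Sum>m<n. q (y1 m) ^ 3) = (\<Sum>m<n. q (z m) ^ 3) + 3 * \<epsilon>"
    using shift[of \<epsilon>] \<epsilon>(1) by auto
  obtain y2 where y2: "y2 \<in> unit_sphere n" "g y2 = g z + B s1 s2 * (- \<epsilon>)"
    using shift[of "- \<epsilon>"] \<epsilon>(1) by auto
  \<comment> \<open>Both signs of the shift give values not below the minimum, so the slope in e3 is
    0.\<close>
  have "g y1 = g z" using min[OF y1(1)] min[OF y2(1)] y1(2) y2(2) by simp
  from max[OF y1(1) this] show False using y1(3) \<epsilon>(1) by simp
qed

text \<open>Single monomials are not symmetric, only their sum \<open>F\<close> is. Averaging over
  the six permutations, generated by the two swaps in \<open>sym\<close>, replaces each monomial by
  \<open>sym_monom3\<close>.\<close>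

lemma symmetrised_affine:
  fixes F :: "real \<Rightarrow> real \<Rightarrow> real \<Rightarrow> real"
  assumes F: "\<And>u v w. F u v w = (\<Sum>\<alpha>\<in>I. C \<alpha> * (q u ^ a \<alpha> * q v ^ b \<alpha> * q w ^ c \<alpha>))"
    and sym: "\<And>u v w. F u v w = F v u w" "\<And>u v w. F u v w = F u w v"
    and deg: "\<And>\<alpha>. \<alpha> \<in> I \<Longrightarrow> a \<alpha> + b \<alpha> + c \<alpha> \<le> 5"
  shows "\<exists>\<phi>. affine_in_e3 \<phi> \<and> (\<forall>u v w. F u v w = \<phi> (q u) (q v) (q w))"
proof (intro exI conjI allI)
  let ?\<phi> = "\<lambda>u v w. (1 / 6) * (\<Sum>\<alpha>\<in>I. C \<alpha> * sym_monom3 (a \<alpha>) (b \<alpha>) (c \<alpha>) u v w)"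
  show "affine_in_e3 ?\<phi>"
    using deg by (intro affine_in_e3_scale affine_in_e3_sum sym_monom3_affine)
  fix u v w
  have "6 * F u v w = F u v w + F u w v + F v u w + F v w u + F w u v + F w v u"
    using sym[of u v w] sym[of v w u] sym[of w u v] sym[of w v u] sym[of u w v] sym[of v u w]
    by linarith
  also have "\<dots> = (\<Sum>\<alpha>\<in>I. C \<alpha> * sym_monom3 (a \<alpha>) (b \<alpha>) (c \<alpha>) (q u) (q v) (q w))"
    unfolding F sum.distrib[symmetric]
    by (intro sum.cong) (simp_all add: sym_monom3_def algebra_simps)
  finally show "F u v w = ?\<phi> (q u) (q v) (q w)" by simp
qed

text \<open>Evenness holds for the sum and not term by term. Averaging over u and -u cancels the odd
  powers.\<close>

lemma even_part:
  fixes C :: "'a \<Rightarrow> real"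
  assumes "(\<Sum>\<alpha>\<in>I. C \<alpha> * u ^ a \<alpha>) = (\<Sum>\<alpha>\<in>I. C \<alpha> * (- u) ^ a \<alpha>)"
  shows "(\<Sum>\<alpha>\<in>I. C \<alpha> * u ^ a \<alpha>) =
    (\<Sum>\<alpha>\<in>I. C \<alpha> * of_bool (even (a \<alpha>)) * (u\<^sup>2) ^ (a \<alpha> div 2))"
proof -
  have "2 * (\<Sum>\<alpha>\<in>I. C \<alpha> * u ^ a \<alpha>) = (\<Sum>\<alpha>\<in>I. C \<alpha> * u ^ a \<alpha> + C \<alpha> * (- u) ^ a \<alpha>)"
    using assms by (simp add: sum.distrib)
  also have "\<dots> = (\<Sum>\<alpha>\<in>I. 2 * (C \<alpha> * of_bool (even (a \<alpha>)) * (u\<^sup>2) ^ (a \<alpha> div 2)))"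
    by (intro sum.cong) (auto simp flip: power_mult)
  finally show ?thesis by (simp add: sum_distrib_left[symmetric])
qed

section \<open>Forms as functions on points, and the group actions\<close>

lemma poly_eval_vec:
  assumes "f \<in> forms n d"
  shows "poly_eval f (vec n x) =
    (\<Sum>\<alpha>\<in>Poly_Mapping.keys f. Poly_Mapping.lookup f \<alpha> * (\<Prod>i<n. x i ^ Poly_Mapping.lookup \<alpha> i))"
  unfolding poly_eval_def
proof (intro sum.cong refl arg_cong2[where f = "(*)"])
  fix \<alpha> assume "\<alpha> \<in> Poly_Mapping.keys f"
  then have sub: "Poly_Mapping.keys \<alpha> \<subseteq> {..<n}" using assms by (auto simp: forms_def)
  show "(\<Prod>i\<in>Poly_Mapping.keys \<alpha>. vec n x $ i ^ Poly_Mapping.lookup \<alpha> i) =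
      (\<Prod>i<n. x i ^ Poly_Mapping.lookup \<alpha> i)"
    by (rule prod.mono_neutral_cong_left) (use sub in \<open>auto simp: in_keys_iff subset_iff\<close>)
qed

lemma forms_degree:
  assumes "f \<in> forms n d" "\<alpha> \<in> Poly_Mapping.keys f"
  shows "(\<Sum>i<n. Poly_Mapping.lookup \<alpha> i) = d"
proof -
  have sub: "Poly_Mapping.keys \<alpha> \<subseteq> {..<n}" using assms by (auto simp: forms_def)
  have "(\<Sum>i<n. Poly_Mapping.lookup \<alpha> i) = (\<Sum>i\<in>Poly_Mapping.keys \<alpha>. Poly_Mapping.lookup \<alpha> i)"
    by (rule sum.mono_neutral_right) (use sub in \<open>auto simp: in_keys_iff\<close>)
  then show ?thesis using assms by (auto simp: forms_def)
qed

lemma continuous_on_poly_eval_vec: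
  assumes "f \<in> forms n d"
  shows "continuous_on A (\<lambda>x. poly_eval f (vec n x))"
  unfolding poly_eval_vec[OF assms] by (intro continuous_intros)

lemma poly_eval_vec_scale:
  assumes "f \<in> forms n d"
  shows "poly_eval f (vec n (\<lambda>i. c * x i)) = c ^ d * poly_eval f (vec n x)"
proof -
  have "(\<Prod>i<n. (c * x i) ^ Poly_Mapping.lookup \<alpha> i) =
      c ^ d * (\<Prod>i<n. x i ^ Poly_Mapping.lookup \<alpha> i)" if "\<alpha> \<in> Poly_Mapping.keys f" for \<alpha>
    using forms_degree[OF assms that]
    by (simp add: power_mult_distrib prod.distrib power_sum[symmetric])
  then show ?thesis
    unfolding poly_eval_vec[OF assms] by (simp add: sum_distrib_left algebra_simps)
qed

lemma poly_eval_permute: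
  assumes "f \<in> invariant_forms (coord_perms n) n d" "\<sigma> permutes {..<n}"
  shows "poly_eval f (vec n (\<lambda>i. x (\<sigma> i))) = poly_eval f (vec n x)"
proof -
  have "vec n (\<lambda>i. x (\<sigma> i)) = vec n (\<lambda>i. vec n x $ \<sigma> i)"
    using permutes_in_image[OF assms(2)] by (intro eq_vecI) auto
  then show ?thesis
    using assms unfolding invariant_forms_def coord_perms_def by (auto simp: vec_carrier)
qed

lemma poly_eval_signed_permute:
  assumes "f \<in> invariant_forms (signed_coord_perms n) n d" "\<sigma> permutes {..<n}"
    "\<And>i. i < n \<Longrightarrow> \<epsilon> i = 1 \<or> \<epsilon> i = -1"
  shows "poly_eval f (vec n (\<lambda>i. \<epsilon> i * x (\<sigma> i))) = poly_eval f (vec n x)"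
proof -
  have eq: "vec n (\<lambda>i. \<epsilon> i * x (\<sigma> i)) = vec n (\<lambda>i. \<epsilon> i * vec n x $ \<sigma> i)"
    using permutes_in_image[OF assms(2)] by (intro eq_vecI) auto
  have "(\<lambda>x. vec n (\<lambda>i. \<epsilon> i * x $ \<sigma> i)) \<in> signed_coord_perms n"
    unfolding signed_coord_perms_def using assms(2,3) by blast
  then have "poly_eval f ((\<lambda>x. vec n (\<lambda>i. \<epsilon> i * x $ \<sigma> i)) (vec n x)) = poly_eval f (vec n x)"
    using assms(1) unfolding invariant_forms_def by (simp only: mem_Collect_eq Ball_def) (meson vec_carrier)
  then show ?thesis by (simp only: eq)
qed

lemma signed_invariant_imp_invariant:
  "invariant_forms (signed_coord_perms n) n d \<subseteq> invariant_forms (coord_perms n) n d"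
proof -
  have "coord_perms n \<subseteq> signed_coord_perms n"
    unfolding coord_perms_def signed_coord_perms_def
    by (auto intro!: exI[of _ "\<lambda>_. 1 :: real"])
  then show ?thesis by (auto simp: invariant_forms_def)
qed

section \<open>Restriction of an invariant form to three coordinates\<close>

context
  fixes n d i j k :: nat and f :: real_mpoly and z :: "nat \<Rightarrow> real"
  assumes ijk: "i < n" "j < n" "k < n" "i \<noteq> j" "i \<noteq> k" "j \<noteq> k"
    and f: "f \<in> invariant_forms (coord_perms n) n d"
begin

private definition "F u v w = poly_eval f (vec n (z(i := u, j := v, k := w)))"

private definition "C \<alpha> = Poly_Mapping.lookup f \<alpha> *
  (\<Prod>m\<in>{..<n} - {i, j, k}. z m ^ Poly_Mapping.lookup \<alpha> m)"

private lemma f_forms: "f \<in> forms n d"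
  using f by (simp add: invariant_forms_def)

private lemma F_expand: "F u v w = (\<Sum>\<alpha>\<in>Poly_Mapping.keys f. C \<alpha> * (u ^ Poly_Mapping.lookup \<alpha> i *
    v ^ Poly_Mapping.lookup \<alpha> j * w ^ Poly_Mapping.lookup \<alpha> k))"
  unfolding F_def C_def poly_eval_vec[OF f_forms] prod_update3[OF ijk] by (simp add: algebra_simps)

private lemma F_swap: "F u v w = F v u w" "F u v w = F u w v"
proof -
  have *: "poly_eval f (vec n (\<lambda>m. y (transpose a b m))) = poly_eval f (vec n y)"
    if "a < n" "b < n" for a b y
    using that poly_eval_permute[OF f permutes_swap_id, of a b y] by simp
  have "(\<lambda>m. (z(i := v, j := u, k := w)) (transpose i j m)) = z(i := u, j := v, k := w)"
    using ijk by (auto simp: transpose_def)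
  with *[of i j "z(i := v, j := u, k := w)"] show "F u v w = F v u w"
    using ijk by (simp add: F_def)
  have "(\<lambda>m. (z(i := u, j := w, k := v)) (transpose j k m)) = z(i := u, j := v, k := w)"
    using ijk by (auto simp: transpose_def)
  with *[of j k "z(i := u, j := w, k := v)"] show "F u v w = F u w v"
    using ijk by (simp add: F_def)
qed

private lemma degree_triple:
  assumes "\<alpha> \<in> Poly_Mapping.keys f"
  shows "Poly_Mapping.lookup \<alpha> i + Poly_Mapping.lookup \<alpha> j + Poly_Mapping.lookup \<alpha> k \<le> d"
proof -
  have "(\<Sum>m\<in>{i, j, k}. Poly_Mapping.lookup \<alpha> m) \<le> (\<Sum>m<n. Poly_Mapping.lookup \<alpha> m)"
    using ijk by (intro sum_mono2) auto
  then show ?thesis using ijk forms_degree[OF f_forms assms] by simp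
qed

lemma invariant_triple_affine:
  assumes "d \<le> 5"
  shows "\<exists>\<phi>. affine_in_e3 \<phi> \<and>
    (\<forall>u v w. poly_eval f (vec n (z(i := u, j := v, k := w))) = \<phi> u v w)"
proof -
  have "\<exists>\<phi>. affine_in_e3 \<phi> \<and> (\<forall>u v w. F u v w = \<phi> (id u) (id v) (id w))"
  proof (rule symmetrised_affine[OF _ F_swap])
    show "F u v w = (\<Sum>\<alpha>\<in>Poly_Mapping.keys f. C \<alpha> * (id u ^ Poly_Mapping.lookup \<alpha> i *
        id v ^ Poly_Mapping.lookup \<alpha> j * id w ^ Poly_Mapping.lookup \<alpha> k))" for u v w
      by (simp add: F_expand)
    fix \<alpha> assume "\<alpha> \<in> Poly_Mapping.keys f"
    from degree_triple[OF this] assms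
    show "Poly_Mapping.lookup \<alpha> i + Poly_Mapping.lookup \<alpha> j + Poly_Mapping.lookup \<alpha> k \<le> 5" by simp
  qed
  then show ?thesis by (simp add: F_def)
qed

text \<open>Sign changes leave only even exponents. In terms of the squares the exponents are
  halved, and the halves of numbers adding up to at most 11 add up to at most 5.\<close>

lemma signed_invariant_triple_affine:
  assumes "d \<le> 11" "f \<in> invariant_forms (signed_coord_perms n) n d"
  shows "\<exists>\<phi>. affine_in_e3 \<phi> \<and>
    (\<forall>u v w. poly_eval f (vec n (z(i := u, j := v, k := w))) = \<phi> (u\<^sup>2) (v\<^sup>2) (w\<^sup>2))"
proof -
  have flip: "poly_eval f (vec n (y(a := - y a))) = poly_eval f (vec n y)" for y a
  proof -
    have "y(a := - y a) = (\<lambda>m. (if m = a then -1 else 1) * y (id m))" by auto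
    then show ?thesis
      using poly_eval_signed_permute[OF assms(2) permutes_id, of "\<lambda>m. if m = a then -1 else 1" y]
      by simp
  qed
  have upd: "(z(i := u, j := v, k := w))(i := - u) = z(i := - u, j := v, k := w)"
    "(z(i := u, j := v, k := w))(j := - v) = z(i := u, j := - v, k := w)"
    "(z(i := u, j := v, k := w))(k := - w) = z(i := u, j := v, k := - w)" for u v w
    using ijk by (auto intro!: ext)
  have app: "(z(i := u, j := v, k := w)) i = u" "(z(i := u, j := v, k := w)) j = v"
    "(z(i := u, j := v, k := w)) k = w" for u v w
    using ijk by auto
  have flipF: "F (- u) v w = F u v w" "F u (- v) w = F u v w" "F u v (- w) = F u v w" for u v w
    using flip[of "z(i := u, j := v, k := w)" i] flip[of "z(i := u, j := v, k := w)" j]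
      flip[of "z(i := u, j := v, k := w)" k]
    by (simp_all only: F_def upd app)
  let ?I = "Poly_Mapping.keys f" and ?l = "Poly_Mapping.lookup"
  let ?E = "\<lambda>\<alpha> m. of_bool (even (?l \<alpha> m)) :: real"
  let ?H = "\<lambda>\<alpha> u m. (u\<^sup>2 :: real) ^ (?l \<alpha> m div 2)"
  \<comment> \<open>One variable at a time: the powers of the other two are absorbed into the
    coefficients. The parity factor removes odd exponents, so \<open>div 2\<close> is exact wherever
    a term survives.\<close>
  have 1: "F u v w = (\<Sum>\<alpha>\<in>?I. (C \<alpha> * (v ^ ?l \<alpha> j * w ^ ?l \<alpha> k)) * ?E \<alpha> i * ?H \<alpha> u i)" for u v w
  proof -
    have *: "F t v w = (\<Sum>\<alpha>\<in>?I. (C \<alpha> * (v ^ ?l \<alpha> j * w ^ ?l \<alpha> k)) * t ^ ?l \<alpha> i)" for t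
      by (simp only: F_expand mult_ac)
    show ?thesis
      using flipF(1)[of u v w] unfolding * by (intro even_part) (rule sym)
  qed
  have 2: "F u v w = (\<Sum>\<alpha>\<in>?I. (C \<alpha> * w ^ ?l \<alpha> k * ?E \<alpha> i * ?H \<alpha> u i) * ?E \<alpha> j * ?H \<alpha> v j)" for u v w
  proof -
    have *: "F u t w = (\<Sum>\<alpha>\<in>?I. (C \<alpha> * w ^ ?l \<alpha> k * ?E \<alpha> i * ?H \<alpha> u i) * t ^ ?l \<alpha> j)" for t
      by (simp only: 1 mult_ac)
    show ?thesis
      using flipF(2)[of u v w] unfolding * by (intro even_part) (rule sym)
  qed
  have 3: "F u v w = (\<Sum>\<alpha>\<in>?I. (C \<alpha> * ?E \<alpha> i * ?H \<alpha> u i * ?E \<alpha> j * ?H \<alpha> v j) * ?E \<alpha> k * ?H \<alpha> w k)"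
    for u v w
  proof -
    have *: "F u v t = (\<Sum>\<alpha>\<in>?I. (C \<alpha> * ?E \<alpha> i * ?H \<alpha> u i * ?E \<alpha> j * ?H \<alpha> v j) * t ^ ?l \<alpha> k)" for t
      by (simp only: 2 mult_ac)
    show ?thesis
      using flipF(3)[of u v w] unfolding * by (intro even_part) (rule sym)
  qed
  have 4: "F u v w = (\<Sum>\<alpha>\<in>?I. (C \<alpha> * ?E \<alpha> i * ?E \<alpha> j * ?E \<alpha> k) *
      (?H \<alpha> u i * ?H \<alpha> v j * ?H \<alpha> w k))" for u v w
    by (simp only: 3 mult_ac)
  have "\<exists>\<phi>. affine_in_e3 \<phi> \<and> (\<forall>u v w. F u v w = \<phi> (u\<^sup>2) (v\<^sup>2) (w\<^sup>2))"
  proof (rule symmetrised_affine[OF 4 F_swap])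
    fix \<alpha> assume "\<alpha> \<in> ?I"
    from degree_triple[OF this] assms(1)
    show "?l \<alpha> i div 2 + ?l \<alpha> j div 2 + ?l \<alpha> k div 2 \<le> 5" by linarith
  qed
  then show ?thesis by (simp add: F_def)
qed

end

section \<open>Reduction to points with two values and zeros\<close>

text \<open>Here \<open>b\<close> is the position where the values \<open>y\<close> end, not their number.\<close>

definition two_valued :: "nat \<Rightarrow> nat \<Rightarrow> real \<Rightarrow> real \<Rightarrow> nat \<Rightarrow> real" where
  "two_valued a b x y i = (if i < a then x else if i < b then y else 0)"

text \<open>Sorting by value: lists with equal multisets differ by a permutation. The block lengths
  are built by induction, since x, y and 0 may coincide and counting occurrences would count entries
  twice.\<close>

lemma permute_to_two_valued:
  assumes "\<And>i. i < n \<Longrightarrow> z i \<in> {x, y, 0}"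
  obtains a b \<sigma> where "a \<le> n" "b \<le> n" "\<sigma> permutes {..<n}"
    "\<And>i. i < n \<Longrightarrow> z (\<sigma> i) = two_valued a b x y i"
proof -
  have mset: "\<exists>a b c. mset xs = mset (replicate a x @ replicate b y @ replicate c 0)"
    if "set xs \<subseteq> {x, y, 0}" for xs :: "real list"
    using that
  proof (induction xs)
    case Nil
    then show ?case by (intro exI[of _ 0]) simp
  next
    case (Cons t xs)
    then obtain a b c where abc: "mset xs = mset (replicate a x @ replicate b y @ replicate c 0)"
      by auto
    consider "t = x" | "t = y" | "t = 0" using Cons.prems by auto
    then show ?case
    proof cases
      case 1
      then show ?thesis using abc by (intro exI[of _ "Suc a"] exI[of _ b] exI[of _ c]) simp
    next
      case 2
      then show ?thesis using abc by (intro exI[of _ a] exI[of _ "Suc b"] exI[of _ c]) simp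
    next
      case 3
      then show ?thesis using abc by (intro exI[of _ a] exI[of _ b] exI[of _ "Suc c"]) simp
    qed
  qed
  have "z ` {..<n} \<subseteq> {x, y, 0}" using assms by blast
  then have "set (map z [0..<n]) \<subseteq> {x, y, 0}" by (simp add: atLeast0LessThan)
  from mset[OF this] obtain a b c
    where abc: "mset (map z [0..<n]) = mset (replicate a x @ replicate b y @ replicate c 0)" by blast
  let ?t = "replicate a x @ replicate b y @ replicate c 0"
  from abc obtain \<sigma> where \<sigma>: "\<sigma> permutes {..<length (map z [0..<n])}"
    "permute_list \<sigma> (map z [0..<n]) = ?t"
    by (metis mset_eq_permutation)
  have len: "n = a + b + c" using arg_cong[OF abc, of size] by simp
  have "z (\<sigma> i) = two_valued a (a + b) x y i" if i: "i < n" for i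
  proof -
    have "\<sigma> i < n" using \<sigma>(1) i permutes_in_image[of \<sigma> "{..<n}" i] by simp
    then have "z (\<sigma> i) = ?t ! i"
      using permute_list_nth[OF \<sigma>(1), of i] i by (simp add: \<sigma>(2))
    then show ?thesis using i len by (auto simp: nth_append two_valued_def)
  qed
  then show ?thesis using that[of a "a + b" \<sigma>] len \<sigma>(1) by simp
qed

lemma at_most_two_values:
  fixes A :: "real set"
  assumes "finite A" "\<And>a b c. a \<in> A \<Longrightarrow> b \<in> A \<Longrightarrow> c \<in> A \<Longrightarrow> a < b \<Longrightarrow> b < c \<Longrightarrow> False"
  obtains x y where "A \<subseteq> {x, y}"
proof (cases "A = {}")
  case False
  have "A \<subseteq> {Min A, Max A}"
  proof
    fix a assume a: "a \<in> A"
    have "Min A \<le> a" "a \<le> Max A" "Min A \<in> A" "Max A \<in> A"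
      using a False assms(1) by auto
    then show "a \<in> {Min A, Max A}"
      using assms(2)[of "Min A" a "Max A"] a by (metis insert_iff order_le_less)
  qed
  then show ?thesis using that by blast
qed (use that in blast)

definition nonneg_two_valued :: "nat \<Rightarrow> real_mpoly \<Rightarrow> bool" where
  "nonneg_two_valued n f \<longleftrightarrow> (\<forall>a\<le>n. \<forall>b\<le>n. \<forall>x y. 0 \<le> poly_eval f (vec n (two_valued a b x y)))"

lemma nonneg_poly_from_sphere:
  assumes f: "f \<in> forms n d" and "nonneg_two_valued n f"
    and sphere: "\<And>x. x \<in> unit_sphere n \<Longrightarrow> 0 \<le> poly_eval f (vec n x)"
  shows "nonneg_poly n f"
  unfolding nonneg_poly_def
proof
  fix v :: "real vec" assume v: "v \<in> carrier_vec n"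
  define N where "N = sqrt (\<Sum>i<n. (v $ i)\<^sup>2)"
  show "0 \<le> poly_eval f v"
  proof (cases "N = 0")
    \<comment> \<open>The origin cannot be normalised, but it is itself a test point.\<close>
    case True
    then have "\<forall>i<n. v $ i = 0" by (simp add: N_def sum_nonneg_eq_0_iff)
    then have "v = vec n (two_valued 0 0 0 0)" using v by (intro eq_vecI) (auto simp: two_valued_def)
    then show ?thesis using assms(2) by (simp add: nonneg_two_valued_def)
  next
    case False
    then have "N > 0" by (simp add: N_def sum_nonneg less_le)
    define x where "x i = (if i < n then v $ i / N else 0)" for i
    have "(\<Sum>i<n. (x i)\<^sup>2) = (\<Sum>i<n. (v $ i)\<^sup>2) / N\<^sup>2"
      by (simp add: x_def power_divide sum_divide_distrib)
    also have "\<dots> = 1" using False by (simp add: N_def sum_nonneg)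
    finally have "x \<in> unit_sphere n" by (simp add: unit_sphere_def x_def)
    then have "0 \<le> poly_eval f (vec n x)" by (rule sphere)
    moreover have "v = vec n (\<lambda>i. N * x i)"
      using v \<open>N > 0\<close> by (intro eq_vecI) (auto simp: x_def)
    ultimately show ?thesis
      using poly_eval_vec_scale[OF f, of N x] \<open>N > 0\<close> by simp
  qed
qed

lemma half_degree_symmetric:
  assumes f: "f \<in> invariant_forms (coord_perms n) n d" and d: "d \<le> 5"
    and two: "nonneg_two_valued n f"
  shows "nonneg_poly n f"
proof (rule nonneg_poly_from_sphere[OF _ two])
  show forms: "f \<in> forms n d" using f by (simp add: invariant_forms_def)
  fix x0 assume x0: "x0 \<in> unit_sphere n"
  define g where "g x = poly_eval f (vec n x)" for x
  have ne: "unit_sphere n \<noteq> {}" using x0 by auto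
  have cont_g: "continuous_on UNIV g" unfolding g_def by (rule continuous_on_poly_eval_vec[OF forms])
  have cont_h: "continuous_on UNIV (\<lambda>x :: nat \<Rightarrow> real. \<Sum>m<n. x m ^ 3)" by (intro continuous_intros)
  obtain z where z: "z \<in> unit_sphere n" "\<And>y. y \<in> unit_sphere n \<Longrightarrow> g z \<le> g y"
    "\<And>y. y \<in> unit_sphere n \<Longrightarrow> g y = g z \<Longrightarrow> (\<Sum>m<n. y m ^ 3) \<le> (\<Sum>m<n. z m ^ 3)"
    by (rule extremal_minimiser[OF compact_unit_sphere ne cont_g cont_h]) blast
  have "False" if abc: "a \<in> z ` {..<n}" "b \<in> z ` {..<n}" "c \<in> z ` {..<n}" "a < b" "b < c" for a b c
  proof -
    from abc(1-3) obtain i j k where "i < n" "j < n" "k < n" "a = z i" "b = z j" "c = z k" by blast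
    with abc(4,5) have ijk: "i < n" "j < n" "k < n" "z i < z j" "z j < z k" by simp_all
    then have "i \<noteq> j" "i \<noteq> k" "j \<noteq> k" by auto
    from invariant_triple_affine[OF ijk(1-3) this f d, of z]
    obtain \<phi> where "affine_in_e3 \<phi> \<and> (\<forall>u v w. g (z(i := u, j := v, k := w)) = \<phi> u v w)"
      unfolding g_def by (rule exE)
    then have \<phi>: "affine_in_e3 \<phi>" "\<And>u v w. g (z(i := u, j := v, k := w)) = \<phi> u v w" by simp_all
    show False
    \<comment> \<open>Every real number is a value of the identity, so any bound below
      \<open>z i\<close> serves as \<open>l\<close>. \<open>N\<close> is e1^2 - 2 e2.\<close>
    proof (rule extremal_not_three_values[where g = g and q = "\<lambda>t. t" and z = z and \<phi> = \<phi>
          and l = "z i - 1" and N = "\<lambda>s t. s * s - 2 * t", OF z ijk \<phi>])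
      show "u\<^sup>2 + v\<^sup>2 + w\<^sup>2 = (u + v + w) * (u + v + w) - 2 * (u * v + u * w + v * w)"
        for u v w :: real by (simp add: algebra_simps power2_eq_square)
      show "z i - 1 < z i" by simp
      show "\<exists>u. u = U" for U :: real by (rule exI) (rule refl)
    qed
  qed
  then obtain x y where "z ` {..<n} \<subseteq> {x, y}"
    using at_most_two_values[of "z ` {..<n}"] by blast
  then have "z i \<in> {x, y, 0}" if "i < n" for i using that by blast
  from permute_to_two_valued[of n z x y, OF this] obtain a b \<sigma> where ab: "a \<le> n" "b \<le> n" "\<sigma> permutes {..<n}"
    "\<And>i. i < n \<Longrightarrow> z (\<sigma> i) = two_valued a b x y i" by blast
  have "g z = poly_eval f (vec n (\<lambda>i. z (\<sigma> i)))"
    using poly_eval_permute[OF f ab(3), of z] by (simp add: g_def)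
  also have "vec n (\<lambda>i. z (\<sigma> i)) = vec n (two_valued a b x y)" using ab(4) by (intro eq_vecI) auto
  finally have "0 \<le> g z" using two ab(1,2) by (simp add: nonneg_two_valued_def)
  then show "0 \<le> poly_eval f (vec n x0)" using z(2)[OF x0] by (simp add: g_def)
qed

lemma half_degree_signed_symmetric:
  assumes f: "f \<in> invariant_forms (signed_coord_perms n) n d" and d: "d \<le> 11"
    and two: "nonneg_two_valued n f"
  shows "nonneg_poly n f"
proof (rule nonneg_poly_from_sphere[OF _ two])
  show forms: "f \<in> forms n d" using f by (simp add: invariant_forms_def)
  fix x0 assume x0: "x0 \<in> unit_sphere n"
  define g where "g x = poly_eval f (vec n x)" for x
  have ne: "unit_sphere n \<noteq> {}" using x0 by auto
  have cont_g: "continuous_on UNIV g" unfolding g_def by (rule continuous_on_poly_eval_vec[OF forms])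
  have cont_h: "continuous_on UNIV (\<lambda>x :: nat \<Rightarrow> real. \<Sum>m<n. (x m)\<^sup>2 ^ 3)"
    by (intro continuous_intros)
  obtain z where z: "z \<in> unit_sphere n" "\<And>y. y \<in> unit_sphere n \<Longrightarrow> g z \<le> g y"
    "\<And>y. y \<in> unit_sphere n \<Longrightarrow> g y = g z \<Longrightarrow> (\<Sum>m<n. (y m)\<^sup>2 ^ 3) \<le> (\<Sum>m<n. (z m)\<^sup>2 ^ 3)"
    by (rule extremal_minimiser[OF compact_unit_sphere ne cont_g cont_h]) blast
  \<comment> \<open>The value 0 is removed: a square cannot move below it.\<close>
  let ?A = "(\<lambda>i. (z i)\<^sup>2) ` {..<n} - {0}"
  have "False" if abc: "a \<in> ?A" "b \<in> ?A" "c \<in> ?A" "a < b" "b < c" for a b c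
  proof -
    from abc obtain i j k where ijk: "i < n" "j < n" "k < n" "(z i)\<^sup>2 < (z j)\<^sup>2" "(z j)\<^sup>2 < (z k)\<^sup>2"
      and pos: "0 < (z i)\<^sup>2" by auto
    then have "i \<noteq> j" "i \<noteq> k" "j \<noteq> k" by auto
    from signed_invariant_triple_affine[OF ijk(1-3) this _ d f, of z]
    obtain \<phi> where \<phi>: "affine_in_e3 \<phi>"
      "\<And>u v w. g (z(i := u, j := v, k := w)) = \<phi> (u\<^sup>2) (v\<^sup>2) (w\<^sup>2)"
      unfolding g_def using f signed_invariant_imp_invariant by blast
    have root: "\<exists>u. u\<^sup>2 = U" if "0 < U" for U :: real
      using that by (intro exI[of _ "sqrt U"]) simp
    show False
      \<comment> \<open>The squares must remain positive, hence \<open>l = 0\<close>. The sum of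
        squares is e1 of the squares.\<close>
      by (rule extremal_not_three_values[where g = g and q = "\<lambda>t. t\<^sup>2" and z = z and \<phi> = \<phi>
          and l = 0 and N = "\<lambda>s t. s", OF z ijk \<phi> pos root]) auto
  qed
  then obtain x y where xy: "?A \<subseteq> {x, y}"
    using at_most_two_values[of ?A] by blast
  have abs: "\<bar>z i\<bar> \<in> {sqrt x, sqrt y, 0}" if "i < n" for i
  proof (cases "z i = 0")
    case False
    then have "(z i)\<^sup>2 \<in> ?A" using that by auto
    then have "(z i)\<^sup>2 = x \<or> (z i)\<^sup>2 = y" using xy by auto
    then show ?thesis by (metis insertCI real_sqrt_abs)
  qed simp
  from permute_to_two_valued[of n "\<lambda>i. \<bar>z i\<bar>", OF abs] obtain a b \<sigma>
    where ab: "a \<le> n" "b \<le> n" "\<sigma> permutes {..<n}"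
    "\<And>i. i < n \<Longrightarrow> \<bar>z (\<sigma> i)\<bar> = two_valued a b (sqrt x) (sqrt y) i" by blast
  \<comment> \<open>Sign changes make all coordinates nonnegative, so values of equal modulus
    merge.\<close>
  have "g z = poly_eval f (vec n (\<lambda>i. (if z (\<sigma> i) < 0 then -1 else 1) * z (\<sigma> i)))"
    using poly_eval_signed_permute[OF f ab(3), of "\<lambda>i. if z (\<sigma> i) < 0 then -1 else 1" z]
    by (simp add: g_def)
  also have "vec n (\<lambda>i. (if z (\<sigma> i) < 0 then -1 else 1) * z (\<sigma> i)) =
      vec n (two_valued a b (sqrt x) (sqrt y))"
  proof (intro eq_vecI)
    fix i assume "i < dim_vec (vec n (two_valued a b (sqrt x) (sqrt y)))"
    then show "vec n (\<lambda>i. (if z (\<sigma> i) < 0 then -1 else 1) * z (\<sigma> i)) $ i =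
        vec n (two_valued a b (sqrt x) (sqrt y)) $ i"
      using ab(4)[of i] by (auto simp: abs_if split: if_splits)
  qed simp
  finally have "0 \<le> g z" using two ab(1,2) by (simp add: nonneg_two_valued_def)
  then show "0 \<le> poly_eval f (vec n x0)" using z(2)[OF x0] by (simp add: g_def)
qed

section \<open>Linear matrix inequalities\<close>

text \<open>The linear functional with prescribed values on monomials. Point evaluations and the
  entries of a matrix associated with a form are both of this kind.\<close>

definition coeff_functional :: "((nat \<Rightarrow>\<^sub>0 nat) \<Rightarrow> real) \<Rightarrow> real_mpoly \<Rightarrow> real" where
  "coeff_functional w f = (\<Sum>\<alpha>\<in>Poly_Mapping.keys f. Poly_Mapping.lookup f \<alpha> * w \<alpha>)"

lemma coeff_functional_superset:
  assumes "finite A" "Poly_Mapping.keys f \<subseteq> A"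
  shows "coeff_functional w f = (\<Sum>\<alpha>\<in>A. Poly_Mapping.lookup f \<alpha> * w \<alpha>)"
  unfolding coeff_functional_def
  by (rule sum.mono_neutral_left) (use assms in \<open>auto simp: in_keys_iff\<close>)

lemma lookup_poly_scale: "Poly_Mapping.lookup (poly_scale c f) \<alpha> = c * Poly_Mapping.lookup f \<alpha>"
  by (simp add: poly_scale_def map.rep_eq when_def)

lemma keys_poly_scale: "Poly_Mapping.keys (poly_scale c f) \<subseteq> Poly_Mapping.keys f"
  by (auto simp: in_keys_iff lookup_poly_scale)

lemma coeff_functional_add:
  "coeff_functional w (f + g) = coeff_functional w f + coeff_functional w g"
proof -
  let ?A = "Poly_Mapping.keys f \<union> Poly_Mapping.keys g"
  have "Poly_Mapping.keys (f + g) \<subseteq> ?A" by (rule keys_add)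
  then show ?thesis
    by (simp add: coeff_functional_superset[of ?A] lookup_add sum.distrib algebra_simps)
qed

lemma coeff_functional_scale: "coeff_functional w (poly_scale c f) = c * coeff_functional w f"
  by (simp add: coeff_functional_superset[OF _ keys_poly_scale] coeff_functional_def[of w f]
      lookup_poly_scale sum_distrib_left mult.assoc)

lemma coeff_functional_sum:
  "coeff_functional w (\<Sum>j\<in>J. F j) = (\<Sum>j\<in>J. coeff_functional w (F j))"
  by (induction J rule: infinite_finite_induct)
    (simp_all add: coeff_functional_add coeff_functional_def[of w 0])

lemma poly_eval_coeff_functional:
  "poly_eval f x = coeff_functional
     (\<lambda>\<alpha>. \<Prod>i\<in>Poly_Mapping.keys \<alpha>. (x $ i) ^ Poly_Mapping.lookup \<alpha> i) f"
  by (simp add: poly_eval_def coeff_functional_def)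

interpretation mpoly: vector_space poly_scale
  by unfold_locales
    (auto intro!: poly_mapping_eqI simp: lookup_poly_scale lookup_add algebra_simps)

lemma finite_exponents:
  fixes n d :: nat
  shows "finite {\<alpha>. Poly_Mapping.keys \<alpha> \<subseteq> {..<n} \<and>
     (\<Sum>i\<in>Poly_Mapping.keys \<alpha>. Poly_Mapping.lookup \<alpha> i) = d}" (is "finite ?E")
proof (rule inj_on_finite)
  let ?h = "\<lambda>\<alpha>. map (Poly_Mapping.lookup \<alpha>) [0..<n]"
  have eq: "\<alpha> = \<beta>" if "\<alpha> \<in> ?E" "\<beta> \<in> ?E" "?h \<alpha> = ?h \<beta>" for \<alpha> \<beta>
  proof (rule poly_mapping_eqI)
    fix i
    show "Poly_Mapping.lookup \<alpha> i = Poly_Mapping.lookup \<beta> i"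
    proof (cases "i < n")
      case True
      then show ?thesis using that(3) by simp
    next
      case False
      then have "i \<notin> Poly_Mapping.keys \<alpha>" "i \<notin> Poly_Mapping.keys \<beta>" using that(1,2) by auto
      then show ?thesis by (simp add: in_keys_iff)
    qed
  qed
  then show "inj_on ?h ?E" by (intro inj_onI) blast
  show "?h ` ?E \<subseteq> {xs. set xs \<subseteq> {..d} \<and> length xs = n}"
  proof -
    have "Poly_Mapping.lookup \<alpha> i \<le> d" if "\<alpha> \<in> ?E" for \<alpha> i
    proof (cases "i \<in> Poly_Mapping.keys \<alpha>")
      case True
      then have "Poly_Mapping.lookup \<alpha> i \<le> (\<Sum>i\<in>Poly_Mapping.keys \<alpha>. Poly_Mapping.lookup \<alpha> i)"
        by (intro member_le_sum) auto
      then show ?thesis using that by simp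
    qed (simp add: in_keys_iff)
    then show ?thesis by auto
  qed
  show "finite {xs. set xs \<subseteq> {..d} \<and> length xs = n}"
    by (rule finite_lists_length_eq) simp
qed

text \<open>Coordinates for an abstractly given space of forms, needed because the unknowns of a
  spectrahedron are real numbers and not forms.\<close>

lemma finite_basis_of_forms:
  assumes "V \<subseteq> forms n d" "0 \<in> V" "\<And>f g. f \<in> V \<Longrightarrow> g \<in> V \<Longrightarrow> f + g \<in> V"
    "\<And>c f. f \<in> V \<Longrightarrow> poly_scale c f \<in> V"
  obtains l :: nat and b :: "nat \<Rightarrow> real_mpoly" where "V = {(\<Sum>j<l. poly_scale (y j) (b j)) | y. True}"
proof -
  define E where "E = {\<alpha>. Poly_Mapping.keys \<alpha> \<subseteq> {..<n} \<and>
     (\<Sum>i\<in>Poly_Mapping.keys \<alpha>. Poly_Mapping.lookup \<alpha> i) = d}"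
  have finE: "finite E" unfolding E_def by (rule finite_exponents)
  define T where "T = (\<lambda>\<alpha>. Poly_Mapping.single \<alpha> (1 :: real)) ` E"
  have sub: "mpoly.subspace V" using assms(2-4) by (simp add: mpoly.subspace_def)
  have VT: "V \<subseteq> mpoly.span T"
  proof
    fix f assume "f \<in> V"
    then have keys: "Poly_Mapping.keys f \<subseteq> E" using assms(1) by (auto simp: forms_def E_def)
    have "f = (\<Sum>\<alpha>\<in>E. poly_scale (Poly_Mapping.lookup f \<alpha>) (Poly_Mapping.single \<alpha> 1))"
    proof (rule poly_mapping_eqI)
      fix \<beta>
      have "(\<Sum>\<alpha>\<in>E. Poly_Mapping.lookup f \<alpha> * (1 when \<alpha> = \<beta>)) =
          (\<Sum>\<alpha>\<in>E. if \<alpha> = \<beta> then Poly_Mapping.lookup f \<beta> else 0)"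
        by (intro sum.cong) (auto simp: when_def)
      also have "\<dots> = Poly_Mapping.lookup f \<beta>"
        using keys finE by (auto simp: in_keys_iff)
      finally show "Poly_Mapping.lookup f \<beta> = Poly_Mapping.lookup
          (\<Sum>\<alpha>\<in>E. poly_scale (Poly_Mapping.lookup f \<alpha>) (Poly_Mapping.single \<alpha> 1)) \<beta>"
        by (simp add: lookup_sum lookup_poly_scale lookup_single)
    qed
    also have "\<dots> \<in> mpoly.span T"
      by (intro mpoly.span_sum mpoly.span_scale mpoly.span_base) (auto simp: T_def)
    finally show "f \<in> mpoly.span T" .
  qed
  obtain B where B: "B \<subseteq> V" "mpoly.independent B" "V \<subseteq> mpoly.span B"
    by (rule mpoly.maximal_independent_subset)
  \<comment> \<open>An independent set inside the span of finitely many monomials.\<close>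
  have "finite B"
    using mpoly.independent_span_bound[of T B] B VT finE by (auto simp: T_def)
  then obtain bs where bs: "set bs = B" "distinct bs" using finite_distinct_list by blast
  have "V = mpoly.span B"
    using B sub mpoly.span_minimal by blast
  also have "\<dots> = range (\<lambda>u. \<Sum>v\<in>B. poly_scale (u v) v)"
    using \<open>finite B\<close> by (rule mpoly.span_finite)
  also have "\<dots> = {(\<Sum>j<length bs. poly_scale (y j) (bs ! j)) | y. True}"
  proof -
    have bij: "bij_betw ((!) bs) {..<length bs} B" using bs bij_betw_nth by blast
    have 1: "(\<Sum>v\<in>B. poly_scale (u v) v) = (\<Sum>j<length bs. poly_scale (u (bs ! j)) (bs ! j))" for u
      by (rule sum.reindex_bij_betw[OF bij, symmetric])
    have 2: "(\<Sum>j<length bs. poly_scale (y j) (bs ! j)) =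
        (\<Sum>v\<in>B. poly_scale (y (the_inv_into {..<length bs} ((!) bs) v)) v)" for y
      unfolding 1 using bij
      by (intro sum.cong) (auto simp: the_inv_into_f_f bij_betw_def)
    show ?thesis
    proof (intro equalityI subsetI)
      fix f assume "f \<in> range (\<lambda>u. \<Sum>v\<in>B. poly_scale (u v) v)"
      then obtain u where "f = (\<Sum>j<length bs. poly_scale (u (bs ! j)) (bs ! j))" by (auto simp: 1)
      then show "f \<in> {(\<Sum>j<length bs. poly_scale (y j) (bs ! j)) | y. True}"
        by (intro CollectI exI[of _ "\<lambda>j. u (bs ! j)"]) simp
    next
      fix f assume "f \<in> {(\<Sum>j<length bs. poly_scale (y j) (bs ! j)) | y. True}"
      then show "f \<in> range (\<lambda>u. \<Sum>v\<in>B. poly_scale (u v) v)" by (auto simp only: 2)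
    qed
  qed
  finally show ?thesis by (rule that)
qed

section \<open>Positive semidefiniteness and block diagonal sums\<close>

definition psd_kernel :: "nat \<Rightarrow> (nat \<Rightarrow> nat \<Rightarrow> real) \<Rightarrow> bool" where
  "psd_kernel k E \<longleftrightarrow> (\<forall>v. 0 \<le> (\<Sum>r<k. \<Sum>c<k. v r * E r c * v c))"

lemma psd_kernel_cong:
  assumes "\<And>r c. r < k \<Longrightarrow> c < k \<Longrightarrow> E r c = E' r c"
  shows "psd_kernel k E \<longleftrightarrow> psd_kernel k E'"
  unfolding psd_kernel_def using assms by simp

lemma mat_in_sym_mats:
  assumes "\<And>r c. E r c = E c r"
  shows "mat k k (\<lambda>(r, c). E r c) \<in> sym_mats k"
  using assms by (auto simp: sym_mats_def)

lemma psd_mat_iff: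
  assumes "\<And>r c. r < k \<Longrightarrow> c < k \<Longrightarrow> E r c = E c r"
  shows "psd k (mat k k (\<lambda>(r, c). E r c)) \<longleftrightarrow> psd_kernel k E"
proof -
  have sym: "mat k k (\<lambda>(r, c). E r c) \<in> sym_mats k"
    using assms by (auto simp: sym_mats_def)
  have form: "v \<bullet> (mat k k (\<lambda>(r, c). E r c) *\<^sub>v v) = (\<Sum>r<k. \<Sum>c<k. v $ r * E r c * v $ c)"
    if "v \<in> carrier_vec k" for v
    using that
    by (simp add: scalar_prod_def atLeast0LessThan sum_distrib_left mult.assoc)
  have "psd k (mat k k (\<lambda>(r, c). E r c)) \<longleftrightarrow>
      (\<forall>v\<in>carrier_vec k. 0 \<le> (\<Sum>r<k. \<Sum>c<k. v $ r * E r c * v $ c))"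
    unfolding psd_def using sym form by auto
  also have "\<dots> \<longleftrightarrow> psd_kernel k E"
  proof
    assume *: "\<forall>v\<in>carrier_vec k. 0 \<le> (\<Sum>r<k. \<Sum>c<k. v $ r * E r c * v $ c)"
    show "psd_kernel k E"
      unfolding psd_kernel_def
    proof
      fix v :: "nat \<Rightarrow> real"
      show "0 \<le> (\<Sum>r<k. \<Sum>c<k. v r * E r c * v c)"
        using *[rule_format, of "vec k v"] by simp
    qed
  qed (simp add: psd_kernel_def)
  finally show ?thesis .
qed

definition block_kernel ::
    "nat \<Rightarrow> (nat \<Rightarrow> nat \<Rightarrow> real) \<Rightarrow> (nat \<Rightarrow> nat \<Rightarrow> real) \<Rightarrow> nat \<Rightarrow> nat \<Rightarrow> real" where
  "block_kernel k E E' r c =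
     (if r < k \<and> c < k then E r c else if k \<le> r \<and> k \<le> c then E' (r - k) (c - k) else 0)"

lemma sum_lessThan_add:
  fixes f :: "nat \<Rightarrow> 'a :: comm_monoid_add"
  shows "(\<Sum>i<a + b. f i) = (\<Sum>i<a. f i) + (\<Sum>i<b. f (a + i))"
  by (induction b) (simp_all add: add.assoc)

text \<open>The quadratic form splits into the two blocks, and vectors supported on one block
  isolate its summand.\<close>

lemma psd_block_kernel:
  "psd_kernel (k + k') (block_kernel k E E') \<longleftrightarrow> psd_kernel k E \<and> psd_kernel k' E'"
proof -
  have split: "(\<Sum>r<k + k'. \<Sum>c<k + k'. v r * block_kernel k E E' r c * v c) =
      (\<Sum>r<k. \<Sum>c<k. v r * E r c * v c) + (\<Sum>r<k'. \<Sum>c<k'. v (k + r) * E' r c * v (k + c))" for v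
    by (simp add: sum_lessThan_add block_kernel_def)
  show ?thesis
  proof (intro iffI conjI)
    assume *: "psd_kernel (k + k') (block_kernel k E E')"
    show "psd_kernel k E"
      unfolding psd_kernel_def
    proof
      fix v :: "nat \<Rightarrow> real"
      show "0 \<le> (\<Sum>r<k. \<Sum>c<k. v r * E r c * v c)"
        using *[unfolded psd_kernel_def split, rule_format, of "\<lambda>i. if i < k then v i else 0"] by simp
    qed
    show "psd_kernel k' E'"
      unfolding psd_kernel_def
    proof
      fix v :: "nat \<Rightarrow> real"
      show "0 \<le> (\<Sum>r<k'. \<Sum>c<k'. v r * E' r c * v c)"
        using *[unfolded psd_kernel_def split, rule_format, of "\<lambda>i. if i < k then 0 else v (i - k)"]
        by simp
    qed
  next
    assume "psd_kernel k E \<and> psd_kernel k' E'"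
    then show "psd_kernel (k + k') (block_kernel k E E')"
      by (simp add: psd_kernel_def[of "k + k'"] split)
        (simp add: psd_kernel_def add_nonneg_nonneg)
  qed
qed

section \<open>LMIs depending linearly on a form\<close>

definition lmi_entry ::
    "nat \<Rightarrow> ((nat \<Rightarrow>\<^sub>0 nat) \<Rightarrow> nat \<Rightarrow> nat \<Rightarrow> real) \<Rightarrow> (nat \<Rightarrow> nat \<Rightarrow> nat \<Rightarrow> real) \<Rightarrow>
     real_mpoly \<Rightarrow> (nat \<Rightarrow> real) \<Rightarrow> nat \<Rightarrow> nat \<Rightarrow> real" where
  "lmi_entry m L B f x r c = coeff_functional (\<lambda>\<alpha>. L \<alpha> r c) f + (\<Sum>j<m. x j * B j r c)"

text \<open>Common source of both claims: for a fixed form it is a certificate, and projecting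
  \<open>x\<close> away from the joint solutions gives a shadow. Only the size \<open>k\<close> is
  tracked, the number \<open>m\<close> of unknowns is not.\<close>

definition lmi_describes :: "nat \<Rightarrow> real_mpoly set \<Rightarrow> (real_mpoly \<Rightarrow> bool) \<Rightarrow> bool" where
  "lmi_describes k V P \<longleftrightarrow> (\<exists>m L B. (\<forall>\<alpha> r c. L \<alpha> r c = L \<alpha> c r) \<and> (\<forall>j r c. B j r c = B j c r) \<and>
     (\<forall>f\<in>V. P f \<longleftrightarrow> (\<exists>x. psd_kernel k (lmi_entry m L B f x))))"

lemma lmi_describes_subset: "lmi_describes k V P \<Longrightarrow> W \<subseteq> V \<Longrightarrow> lmi_describes k W P"
  unfolding lmi_describes_def by (meson subsetD)

lemma lmi_describes_cong:
  assumes "\<And>f. f \<in> V \<Longrightarrow> P f \<longleftrightarrow> Q f"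
  shows "lmi_describes k V P \<longleftrightarrow> lmi_describes k V Q"
  unfolding lmi_describes_def using assms by simp

lemma lmi_describes_True: "lmi_describes 0 V (\<lambda>_. True)"
  unfolding lmi_describes_def psd_kernel_def
  by (intro exI[of _ 0] exI[of _ "\<lambda>_ _ _. 0"]) simp

text \<open>Block diagonal sum with disjoint unknowns: the first \<open>m\<close> belong to the
  first block, the others to the second.\<close>

lemma lmi_describes_conj:
  assumes "lmi_describes k V P" "lmi_describes k' V P'"
  shows "lmi_describes (k + k') V (\<lambda>f. P f \<and> P' f)"
proof -
  obtain m L B where 1: "\<And>\<alpha> r c. L \<alpha> r c = L \<alpha> c r" "\<And>j r c. B j r c = B j c r"
    "\<And>f. f \<in> V \<Longrightarrow> P f \<longleftrightarrow> (\<exists>x. psd_kernel k (lmi_entry m L B f x))"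
    using assms(1) unfolding lmi_describes_def by blast
  obtain m' L' B' where 2: "\<And>\<alpha> r c. L' \<alpha> r c = L' \<alpha> c r" "\<And>j r c. B' j r c = B' j c r"
    "\<And>f. f \<in> V \<Longrightarrow> P' f \<longleftrightarrow> (\<exists>x. psd_kernel k' (lmi_entry m' L' B' f x))"
    using assms(2) unfolding lmi_describes_def by blast
  define L2 where "L2 \<alpha> = block_kernel k (L \<alpha>) (L' \<alpha>)" for \<alpha>
  define B2 where "B2 j = (if j < m then block_kernel k (B j) (\<lambda>_ _. 0)
    else block_kernel k (\<lambda>_ _. 0) (B' (j - m)))" for j
  have entry: "lmi_entry (m + m') L2 B2 f x =
      block_kernel k (lmi_entry m L B f x) (lmi_entry m' L' B' f (\<lambda>j. x (m + j)))" for f x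
    by (intro ext)
      (auto simp: lmi_entry_def L2_def B2_def block_kernel_def sum_lessThan_add coeff_functional_def)
  have "P f \<and> P' f \<longleftrightarrow> (\<exists>x. psd_kernel (k + k') (lmi_entry (m + m') L2 B2 f x))" if f: "f \<in> V" for f
  proof
    assume "P f \<and> P' f"
    then obtain x x' where x: "psd_kernel k (lmi_entry m L B f x)"
      "psd_kernel k' (lmi_entry m' L' B' f x')" using 1(3)[OF f] 2(3)[OF f] by blast
    let ?x = "\<lambda>j. if j < m then x j else x' (j - m)"
    have "lmi_entry m L B f ?x = lmi_entry m L B f x" by (intro ext) (simp add: lmi_entry_def)
    then have "psd_kernel (k + k') (lmi_entry (m + m') L2 B2 f ?x)"
      using x unfolding entry psd_block_kernel by simp
    then show "\<exists>x. psd_kernel (k + k') (lmi_entry (m + m') L2 B2 f x)" by blast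
  next
    assume "\<exists>x. psd_kernel (k + k') (lmi_entry (m + m') L2 B2 f x)"
    then show "P f \<and> P' f"
      unfolding entry psd_block_kernel using 1(3)[OF f] 2(3)[OF f] by blast
  qed
  moreover have "L2 \<alpha> r c = L2 \<alpha> c r" for \<alpha> r c
    unfolding L2_def block_kernel_def using 1(1) 2(1) by auto
  moreover have "B2 j r c = B2 j c r" for j r c
    unfolding B2_def block_kernel_def using 1(2) 2(2) by auto
  ultimately show ?thesis unfolding lmi_describes_def by blast
qed

lemma lmi_describes_Ball:
  assumes "finite I" "\<And>i. i \<in> I \<Longrightarrow> lmi_describes k V (P i)"
  shows "lmi_describes (card I * k) V (\<lambda>f. \<forall>i\<in>I. P i f)"
  using assms
proof (induction I)
  case empty
  then show ?case using lmi_describes_True by simp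
next
  case (insert i I)
  then show ?case using lmi_describes_conj[of k V "P i" "card I * k"] by simp
qed

lemma lmi_certifiable_if_describes:
  assumes "lmi_describes k V (nonneg_poly n)"
  shows "lmi_certifiable k n V"
proof -
  obtain m L B where sym: "\<And>\<alpha> r c. L \<alpha> r c = L \<alpha> c r" "\<And>j r c. B j r c = B j c r"
    and P: "\<And>f. f \<in> V \<Longrightarrow> nonneg_poly n f \<longleftrightarrow> (\<exists>x. psd_kernel k (lmi_entry m L B f x))"
    using assms unfolding lmi_describes_def by blast
  define M0 :: "real mat" where "M0 = mat k k (\<lambda>(r, c). 0)"
  define M where "M \<alpha> = mat k k (\<lambda>(r, c). L \<alpha> r c)" for \<alpha>
  define C where "C j = mat k k (\<lambda>(r, c). B j r c)" for j
  have syms: "M0 \<in> sym_mats k" "M \<alpha> \<in> sym_mats k" "C j \<in> sym_mats k" for \<alpha> j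
    unfolding M0_def M_def C_def using sym by (auto intro!: mat_in_sym_mats)
  have fm: "form_matrix k M0 M f = mat k k (\<lambda>(r, c). coeff_functional (\<lambda>\<alpha>. L \<alpha> r c) f)" for f
    by (intro eq_matI) (auto simp: form_matrix_def M0_def M_def coeff_functional_def)
  have sym_fm: "form_matrix k M0 M f \<in> sym_mats k" for f
    unfolding fm using sym(1) by (intro mat_in_sym_mats) simp
  have lm: "lmi_matrix k m (form_matrix k M0 M f) C x =
      mat k k (\<lambda>(r, c). lmi_entry m L B f (\<lambda>j. x $ j) r c)" for f x
    by (intro eq_matI) (auto simp: lmi_matrix_def fm C_def lmi_entry_def)
  have psd: "psd k (lmi_matrix k m (form_matrix k M0 M f) C x) \<longleftrightarrow>
      psd_kernel k (lmi_entry m L B f (\<lambda>j. x $ j))" for f x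
    unfolding lm
  proof (rule psd_mat_iff)
    show "lmi_entry m L B f (\<lambda>j. x $ j) r c = lmi_entry m L B f (\<lambda>j. x $ j) c r" for r c
      by (simp only: lmi_entry_def sym(1)[of _ r c] sym(2)[of _ r c])
  qed
  have "(lmi_solutions k m (form_matrix k M0 M f) C \<noteq> {}) \<longleftrightarrow> nonneg_poly n f" if "f \<in> V" for f
  proof -
    have "psd_kernel k (lmi_entry m L B f x) \<longleftrightarrow> psd_kernel k (lmi_entry m L B f (\<lambda>j. vec m x $ j))" for x
      by (rule psd_kernel_cong) (simp add: lmi_entry_def)
    then show ?thesis
      unfolding P[OF that] lmi_solutions_def psd by (auto intro: vec_carrier)
  qed
  then show ?thesis
    unfolding lmi_certifiable_def certifies_nonneg_def is_lmi_def
    using syms sym_fm by (intro exI[of _ m] exI[of _ M0] exI[of _ M] exI[of _ C]) auto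
qed

lemma spectrahedral_shadow_if_describes:
  assumes V: "V \<subseteq> forms n d" "0 \<in> V" "\<And>f g. f \<in> V \<Longrightarrow> g \<in> V \<Longrightarrow> f + g \<in> V"
    "\<And>c f. f \<in> V \<Longrightarrow> poly_scale c f \<in> V"
    and describes: "lmi_describes k V P"
  shows "spectrahedral_shadow {f \<in> V. P f}"
proof -
  obtain l :: nat and b :: "nat \<Rightarrow> real_mpoly" where basis: "V = {(\<Sum>j<l. poly_scale (y j) (b j)) | y. True}"
    using finite_basis_of_forms[OF V] by blast
  obtain m L B where sym: "\<And>\<alpha> r c. L \<alpha> r c = L \<alpha> c r" "\<And>j r c. B j r c = B j c r"
    and P: "\<And>f. f \<in> V \<Longrightarrow> P f \<longleftrightarrow> (\<exists>x. psd_kernel k (lmi_entry m L B f x))"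
    using describes unfolding lmi_describes_def by blast
  \<comment> \<open>The first \<open>l\<close> unknowns are the coordinates of the form and the last
    \<open>m\<close> those of the LMI. The projection \<open>\<pi>\<close> reads off the first
    ones.\<close>
  define E where "E j r c = (if j < l then coeff_functional (\<lambda>\<alpha>. L \<alpha> r c) (b j) else B (j - l) r c)" for j r c
  define A0 :: "real mat" where "A0 = mat k k (\<lambda>(r, c). 0)"
  define A where "A j = mat k k (\<lambda>(r, c). E j r c)" for j
  define \<pi> where "\<pi> z = (\<Sum>j<l. poly_scale (z $ j) (b j))" for z :: "real vec"
  have E_sym: "E j r c = E j c r" for j r c
    by (simp only: E_def sym(1)[of _ r c] sym(2)[of _ r c])
  have syms: "A0 \<in> sym_mats k" "A j \<in> sym_mats k" for j
    unfolding A0_def A_def by (auto intro!: mat_in_sym_mats E_sym)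
  have lm: "lmi_matrix k (l + m) A0 A z = mat k k (\<lambda>(r, c). \<Sum>j<l + m. z $ j * E j r c)" for z
    by (intro eq_matI) (auto simp: lmi_matrix_def A0_def A_def)
  have entry: "(\<Sum>j<l + m. z $ j * E j r c) = lmi_entry m L B (\<pi> z) (\<lambda>j. z $ (l + j)) r c" for z r c
    by (simp add: sum_lessThan_add E_def lmi_entry_def \<pi>_def coeff_functional_sum
        coeff_functional_scale)
  have psd: "psd k (lmi_matrix k (l + m) A0 A z) \<longleftrightarrow>
      psd_kernel k (lmi_entry m L B (\<pi> z) (\<lambda>j. z $ (l + j)))" for z
    unfolding lm entry
  proof (rule psd_mat_iff)
    show "lmi_entry m L B (\<pi> z) (\<lambda>j. z $ (l + j)) r c = lmi_entry m L B (\<pi> z) (\<lambda>j. z $ (l + j)) c r" for r c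
      by (simp only: lmi_entry_def sym(1)[of _ r c] sym(2)[of _ r c])
  qed
  have \<pi>V: "\<pi> z \<in> V" for z
    unfolding basis \<pi>_def by (intro CollectI exI[of _ "\<lambda>j. z $ j"]) simp
  have "linear_to_polys (l + m) \<pi>"
    unfolding linear_to_polys_def
  proof (intro conjI ballI allI)
    fix x y :: "real vec" assume "x \<in> carrier_vec (l + m)" "y \<in> carrier_vec (l + m)"
    then show "\<pi> (x + y) = \<pi> x + \<pi> y"
      by (simp add: \<pi>_def mpoly.scale_left_distrib sum.distrib)
  next
    fix c and x :: "real vec" assume "x \<in> carrier_vec (l + m)"
    then show "\<pi> (c \<cdot>\<^sub>v x) = poly_scale c (\<pi> x)"
      by (simp add: \<pi>_def mpoly.scale_sum_right)
  qed
  moreover have "spectrahedron (l + m) (lmi_solutions k (l + m) A0 A)"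
    unfolding spectrahedron_def is_lmi_def
    by (intro exI[of _ k] exI[of _ A0] exI[of _ A]) (simp add: syms)
  moreover have "{f \<in> V. P f} = \<pi> ` lmi_solutions k (l + m) A0 A"
  proof (intro equalityI subsetI)
    fix f assume "f \<in> {f \<in> V. P f}"
    then have f: "f \<in> V" "P f" by auto
    obtain y where y: "f = (\<Sum>j<l. poly_scale (y j) (b j))" using f(1) unfolding basis by blast
    obtain x where x: "psd_kernel k (lmi_entry m L B f x)" using f(2) P[OF f(1)] by blast
    define z where "z = vec (l + m) (\<lambda>j. if j < l then y j else x (j - l))"
    have "\<pi> z = f" by (simp add: \<pi>_def z_def y)
    moreover have "lmi_entry m L B f (\<lambda>j. z $ (l + j)) = lmi_entry m L B f x"
      by (intro ext) (simp add: lmi_entry_def z_def)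
    ultimately have "psd k (lmi_matrix k (l + m) A0 A z)" unfolding psd using x by simp
    then have "z \<in> lmi_solutions k (l + m) A0 A" by (simp add: lmi_solutions_def z_def)
    then show "f \<in> \<pi> ` lmi_solutions k (l + m) A0 A" using \<open>\<pi> z = f\<close> by blast
  next
    fix f assume "f \<in> \<pi> ` lmi_solutions k (l + m) A0 A"
    then obtain z where z: "f = \<pi> z" "psd k (lmi_matrix k (l + m) A0 A z)"
      by (auto simp: lmi_solutions_def)
    have "P (\<pi> z)" using z(2) unfolding psd P[OF \<pi>V[of z]]
      by (rule exI[of _ "\<lambda>j. z $ (l + j)"])
    then show "f \<in> {f \<in> V. P f}" using \<pi>V[of z] z(1) by simp
  qed
  ultimately show ?thesis unfolding spectrahedral_shadow_def by blast
qed

lemma zero_in_invariant_forms: "0 \<in> invariant_forms G n d"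
  by (simp add: invariant_forms_def forms_def poly_eval_def)

lemma add_in_invariant_forms:
  assumes "f \<in> invariant_forms G n d" "g \<in> invariant_forms G n d"
  shows "f + g \<in> invariant_forms G n d"
proof -
  have "f + g \<in> forms n d"
    using assms keys_add[of f g] unfolding invariant_forms_def forms_def by blast
  moreover have "poly_eval (f + g) x = poly_eval f x + poly_eval g x" for x
    by (simp add: poly_eval_coeff_functional coeff_functional_add)
  ultimately show ?thesis using assms by (simp add: invariant_forms_def)
qed

lemma poly_scale_in_invariant_forms:
  assumes "f \<in> invariant_forms G n d"
  shows "poly_scale c f \<in> invariant_forms G n d"
proof -
  have "poly_scale c f \<in> forms n d"
    using assms keys_poly_scale[of c f] unfolding invariant_forms_def forms_def by blast
  moreover have "poly_eval (poly_scale c f) x = c * poly_eval f x" for x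
    by (simp add: poly_eval_coeff_functional coeff_functional_scale)
  ultimately show ?thesis using assms by (simp add: invariant_forms_def)
qed

section \<open>Binary forms and Gram matrices\<close>

text \<open>The coefficient of t^s in the quadratic form of \<open>E\<close> at (1, t, ...,
  t^(k-1)).\<close>

definition antidiag_sum :: "nat \<Rightarrow> nat \<Rightarrow> (nat \<Rightarrow> nat \<Rightarrow> real) \<Rightarrow> real" where
  "antidiag_sum k s E = (\<Sum>r<k. \<Sum>c<k. if r + c = s then E r c else 0)"

lemma antidiag_sum_add:
  "antidiag_sum k s (\<lambda>r c. E r c + E' r c) = antidiag_sum k s E + antidiag_sum k s E'"
  unfolding antidiag_sum_def sum.distrib[symmetric] by (intro sum.cong) auto

lemma antidiag_sum_scale: "antidiag_sum k s (\<lambda>r c. a * E r c) = a * antidiag_sum k s E"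
  unfolding antidiag_sum_def sum_distrib_left by (intro sum.cong) auto

lemma antidiag_sum_transpose: "antidiag_sum k s (\<lambda>r c. E c r) = antidiag_sum k s E"
  unfolding antidiag_sum_def by (subst sum.swap) (simp add: add.commute)

lemma antidiag_sum_hankel:
  "antidiag_sum k s (\<lambda>r c. h (r + c)) = h s * antidiag_sum k s (\<lambda>_ _. 1)"
  unfolding antidiag_sum_def sum_distrib_left by (intro sum.cong) auto

text \<open>The sum counts the cells of an antidiagonal, later a denominator. The cell with row
  \<open>s div 2\<close> lies inside the matrix.\<close>

lemma antidiag_sum_one_pos:
  assumes "s \<le> 2 * D"
  shows "antidiag_sum (Suc D) s (\<lambda>_ _. 1) > 0"
proof -
  define r where "r = s div 2"
  have r: "r < Suc D" "s - r < Suc D" "r + (s - r) = s" using assms by (auto simp: r_def)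
  have "0 < (if r + (s - r) = s then 1 else 0 :: real)" using r by simp
  also have "\<dots> \<le> (\<Sum>c<Suc D. if r + c = s then 1 else 0)"
    using r by (intro member_le_sum[where f = "\<lambda>c. if r + c = s then 1 else 0 :: real"]) auto
  also have "\<dots> \<le> antidiag_sum (Suc D) s (\<lambda>_ _. 1)"
    unfolding antidiag_sum_def using r
    by (intro member_le_sum[where f = "\<lambda>r. \<Sum>c<Suc D. if r + c = s then 1 else 0 :: real"])
      (auto intro!: sum_nonneg)
  finally show ?thesis .
qed

lemma sum_by_antidiag:
  "(\<Sum>r<Suc D. \<Sum>c<Suc D. E r c * h (r + c)) = (\<Sum>s\<le>2 * D. antidiag_sum (Suc D) s E * h s)"
proof -
  have "(\<Sum>s\<le>2 * D. antidiag_sum (Suc D) s E * h s) =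
      (\<Sum>s\<le>2 * D. \<Sum>r<Suc D. \<Sum>c<Suc D. if r + c = s then E r c * h s else 0)"
    unfolding antidiag_sum_def sum_distrib_right by (intro sum.cong refl) auto
  also have "\<dots> = (\<Sum>r<Suc D. \<Sum>s\<le>2 * D. \<Sum>c<Suc D. if r + c = s then E r c * h s else 0)"
    by (rule sum.swap)
  also have "\<dots> = (\<Sum>r<Suc D. \<Sum>c<Suc D. \<Sum>s\<le>2 * D. if r + c = s then E r c * h s else 0)"
    by (rule sum.cong[OF refl]) (rule sum.swap)
  also have "\<dots> = (\<Sum>r<Suc D. \<Sum>c<Suc D. E r c * h (r + c))"
    by (intro sum.cong refl) auto
  finally show ?thesis by simp
qed

lemma coeff_square_antidiag:
  fixes q :: "real poly"
  assumes "degree q \<le> D"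
  shows "coeff (q * q) s = antidiag_sum (Suc D) s (\<lambda>r c. coeff q r * coeff q c)"
proof -
  have q: "q = (\<Sum>i<Suc D. monom (coeff q i) i)"
    using poly_as_sum_of_monoms'[OF assms] by (simp add: lessThan_Suc_atMost)
  have "q * q = (\<Sum>r<Suc D. \<Sum>c<Suc D. monom (coeff q r * coeff q c) (r + c))"
    by (subst (1 2) q) (simp only: sum_product mult_monom)
  then show ?thesis
    by (simp add: coeff_sum antidiag_sum_def)
qed

text \<open>Squares of real leading coefficients cannot cancel.\<close>

lemma degree_sum_two_squares:
  fixes q r :: "real poly"
  assumes "degree (q * q + r * r) \<le> 2 * D"
  shows "degree q \<le> D \<and> degree r \<le> D"
proof (rule ccontr)
  define m where "m = max (degree q) (degree r)"
  assume "\<not> (degree q \<le> D \<and> degree r \<le> D)"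
  then have m: "m > D" "degree q \<le> m" "degree r \<le> m" by (auto simp: m_def)
  \<comment> \<open>This antidiagonal consists of the corner cell only.\<close>
  have "antidiag_sum (Suc m) (m + m) E = E m m" for E
  proof -
    have "antidiag_sum (Suc m) (m + m) E = (\<Sum>r<Suc m. \<Sum>c<Suc m. if r = m \<and> c = m then E m m else 0)"
      unfolding antidiag_sum_def by (intro sum.cong refl) auto
    then show ?thesis by (simp add: sum.neutral)
  qed
  then have "coeff (q * q + r * r) (m + m) = coeff q m * coeff q m + coeff r m * coeff r m"
    using m coeff_square_antidiag[of _ m "m + m"] by simp
  moreover have "coeff (q * q + r * r) (m + m) = 0"
    using m(1) assms by (intro coeff_eq_0) simp
  ultimately have "coeff q m = 0" "coeff r m = 0"
    by (simp_all add: sum_squares_eq_zero_iff)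
  \<comment> \<open>The polynomial of degree \<open>m\<close> has leading coefficient 0, so it is
    zero and \<open>m = 0\<close>, a contradiction.\<close>
  moreover have "m > 0" using m(1) by simp
  ultimately show False
    unfolding m_def by (metis degree_0 leading_coeff_0_iff max_def less_irrefl)
qed

text \<open>Setting y = 1 gives a sum of two squares, whose coefficient vectors form a Gram matrix.
  Conversely the form is the quadratic form of \<open>Q\<close> at the vector with entries x^r
  y^(D-r).\<close>

lemma nonneg_binary_form_iff:
  "(\<forall>x y. 0 \<le> (\<Sum>s\<le>2 * D. c s * (x ^ s * y ^ (2 * D - s)))) \<longleftrightarrow>
   (\<exists>Q. (\<forall>i j. Q i j = Q j i) \<and> psd_kernel (Suc D) Q \<and> (\<forall>s\<le>2 * D. antidiag_sum (Suc D) s Q = c s))"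
proof
  assume nonneg: "\<forall>x y. 0 \<le> (\<Sum>s\<le>2 * D. c s * (x ^ s * y ^ (2 * D - s)))"
  define p where "p = (\<Sum>s\<le>2 * D. monom (c s) s)"
  have "0 \<le> poly p t" for t
    using nonneg[rule_format, of t 1] by (simp add: p_def poly_sum poly_monom)
  then obtain q r where qr: "p = q * q + r * r" using nonneg_poly_two_squares by blast
  have "degree p \<le> 2 * D" unfolding p_def
    by (intro degree_sum_le) (auto intro: order_trans[OF degree_monom_le])
  then have deg: "degree q \<le> D" "degree r \<le> D"
    using degree_sum_two_squares[of q r D] by (auto simp: qr)
  \<comment> \<open>The sum of the outer products of the two coefficient vectors.\<close>
  define Q where "Q i j = coeff q i * coeff q j + coeff r i * coeff r j" for i j
  have "psd_kernel (Suc D) Q"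
    unfolding psd_kernel_def
  proof
    fix v :: "nat \<Rightarrow> real"
    have "(\<Sum>i<Suc D. \<Sum>j<Suc D. v i * Q i j * v j) =
        (\<Sum>i<Suc D. v i * coeff q i) * (\<Sum>j<Suc D. v j * coeff q j)
        + (\<Sum>i<Suc D. v i * coeff r i) * (\<Sum>j<Suc D. v j * coeff r j)"
      unfolding sum_product sum.distrib[symmetric] Q_def
      by (intro sum.cong refl) (simp add: algebra_simps)
    then show "0 \<le> (\<Sum>i<Suc D. \<Sum>j<Suc D. v i * Q i j * v j)" by simp
  qed
  moreover have "antidiag_sum (Suc D) s Q = c s" if "s \<le> 2 * D" for s
  proof -
    have "antidiag_sum (Suc D) s Q = coeff p s"
      unfolding Q_def antidiag_sum_add qr coeff_add
        coeff_square_antidiag[OF deg(1)] coeff_square_antidiag[OF deg(2)] ..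
    also have "\<dots> = c s" using that by (simp add: p_def coeff_sum)
    finally show ?thesis .
  qed
  moreover have "Q i j = Q j i" for i j by (simp add: Q_def)
  ultimately show "\<exists>Q. (\<forall>i j. Q i j = Q j i) \<and> psd_kernel (Suc D) Q \<and>
      (\<forall>s\<le>2 * D. antidiag_sum (Suc D) s Q = c s)" by blast
next
  assume "\<exists>Q. (\<forall>i j. Q i j = Q j i) \<and> psd_kernel (Suc D) Q \<and>
      (\<forall>s\<le>2 * D. antidiag_sum (Suc D) s Q = c s)"
  then obtain Q where Q: "psd_kernel (Suc D) Q" "\<And>s. s \<le> 2 * D \<Longrightarrow> antidiag_sum (Suc D) s Q = c s"
    by blast
  show "\<forall>x y. 0 \<le> (\<Sum>s\<le>2 * D. c s * (x ^ s * y ^ (2 * D - s)))"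
  proof (intro allI)
    fix x y :: real
    have "(\<Sum>s\<le>2 * D. c s * (x ^ s * y ^ (2 * D - s))) =
        (\<Sum>r<Suc D. \<Sum>t<Suc D. Q r t * (x ^ (r + t) * y ^ (2 * D - (r + t))))"
      unfolding sum_by_antidiag[of Q "\<lambda>s. x ^ s * y ^ (2 * D - s)"] by (simp add: Q)
    also have "\<dots> = (\<Sum>r<Suc D. \<Sum>t<Suc D. (x ^ r * y ^ (D - r)) * Q r t * (x ^ t * y ^ (D - t)))"
    proof (intro sum.cong refl)
      fix r t assume "r \<in> {..<Suc D}" "t \<in> {..<Suc D}"
      \<comment> \<open>Subtraction of naturals splits here because r and t are at most D.\<close>
      then have "2 * D - (r + t) = (D - r) + (D - t)" by simp
      then show "Q r t * (x ^ (r + t) * y ^ (2 * D - (r + t))) =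
          (x ^ r * y ^ (D - r)) * Q r t * (x ^ t * y ^ (D - t))"
        by (simp add: power_add)
    qed
    finally show "0 \<le> (\<Sum>s\<le>2 * D. c s * (x ^ s * y ^ (2 * D - s)))"
      using Q(1) by (simp only: psd_kernel_def)
  qed
qed

section \<open>Forms at two-valued points and their Gram matrices\<close>

definition binary_coeff :: "nat \<Rightarrow> nat \<Rightarrow> nat \<Rightarrow> nat \<Rightarrow> (nat \<Rightarrow>\<^sub>0 nat) \<Rightarrow> real" where
  "binary_coeff n a b s \<alpha> = of_bool ((\<forall>i<n. Poly_Mapping.lookup \<alpha> i \<noteq> 0 \<longrightarrow> i < a \<or> i < b) \<and>
     (\<Sum>i<a. Poly_Mapping.lookup \<alpha> i) = s)"

text \<open>A monomial involving the zero block vanishes. Any other contributes to a single s, its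
  total exponent on the first \<open>a\<close> coordinates. So the binary coefficients are linear in
  the coefficients of \<open>f\<close>.\<close>

lemma poly_eval_two_valued:
  assumes f: "f \<in> forms n d" and a: "a \<le> n"
  shows "poly_eval f (vec n (two_valued a b x y)) =
    (\<Sum>s\<le>d. coeff_functional (binary_coeff n a b s) f * (x ^ s * y ^ (d - s)))"
proof -
  let ?l = "Poly_Mapping.lookup"
  have monomial: "(\<Prod>i<n. two_valued a b x y i ^ ?l \<alpha> i) =
      (\<Sum>s\<le>d. binary_coeff n a b s \<alpha> * (x ^ s * y ^ (d - s)))" if \<alpha>: "\<alpha> \<in> Poly_Mapping.keys f" for \<alpha>
  proof -
    define S where "S = (\<Sum>i<a. ?l \<alpha> i)"
    have n: "n = a + (n - a)" using a by simp
    have deg: "S + (\<Sum>i<n - a. ?l \<alpha> (a + i)) = d"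
      using forms_degree[OF f \<alpha>] unfolding S_def by (metis n sum_lessThan_add)
    define good where "good \<longleftrightarrow> (\<forall>i<n. ?l \<alpha> i \<noteq> 0 \<longrightarrow> i < a \<or> i < b)"
    have "(\<Sum>s\<le>d. binary_coeff n a b s \<alpha> * (x ^ s * y ^ (d - s))) =
        (\<Sum>s\<le>d. if s = S then of_bool good * (x ^ S * y ^ (d - S)) else 0)"
      by (intro sum.cong refl) (auto simp: binary_coeff_def good_def S_def)
    also have "\<dots> = of_bool good * (x ^ S * y ^ (d - S))" using deg by simp
    also have "\<dots> = (\<Prod>i<n. two_valued a b x y i ^ ?l \<alpha> i)"
    proof (cases good)
      case True
      \<comment> \<open>In the zero block all exponents are 0, and 0^0 = 1 allows the base to be
        replaced by y.\<close>
      have "(\<Prod>i<n. two_valued a b x y i ^ ?l \<alpha> i) =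
          (\<Prod>i<n. (if i < a then x else y) ^ ?l \<alpha> i)"
        using True by (intro prod.cong) (auto simp: two_valued_def good_def)
      also have "\<dots> = (\<Prod>i\<in>{..<a} \<union> {a..<n}. (if i < a then x else y) ^ ?l \<alpha> i)"
        using a by (intro prod.cong) auto
      also have "\<dots> = (\<Prod>i<a. (if i < a then x else y) ^ ?l \<alpha> i)
          * (\<Prod>i\<in>{a..<n}. (if i < a then x else y) ^ ?l \<alpha> i)"
        by (rule prod.union_disjoint) auto
      also have "\<dots> = x ^ S * y ^ (\<Sum>i\<in>{a..<n}. ?l \<alpha> i)"
        by (simp add: S_def power_sum)
      also have "(\<Sum>i\<in>{a..<n}. ?l \<alpha> i) = d - S"
        using forms_degree[OF f \<alpha>] a sum.atLeastLessThan_concat[of 0 a n "?l \<alpha>"]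
        by (simp add: S_def atLeast0LessThan)
      finally show ?thesis using True by simp
    next
      case False
      then obtain i where "i < n" "?l \<alpha> i \<noteq> 0" "\<not> i < a" "\<not> i < b" by (auto simp: good_def)
      then have "\<exists>i\<in>{..<n}. two_valued a b x y i ^ ?l \<alpha> i = 0"
        by (intro bexI[of _ i]) (auto simp: two_valued_def)
      then have "(\<Prod>i<n. two_valued a b x y i ^ ?l \<alpha> i) = 0" by (simp add: prod_zero)
      then show ?thesis using False by simp
    qed
    finally show ?thesis by simp
  qed
  have "poly_eval f (vec n (two_valued a b x y)) =
    (\<Sum>\<alpha>\<in>Poly_Mapping.keys f. \<Sum>s\<le>d. ?l f \<alpha> * binary_coeff n a b s \<alpha> * (x ^ s * y ^ (d - s)))"
    unfolding poly_eval_vec[OF f]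
    by (intro sum.cong refl) (simp add: monomial sum_distrib_left mult.assoc)
  also have "\<dots> = (\<Sum>s\<le>d. coeff_functional (binary_coeff n a b s) f * (x ^ s * y ^ (d - s)))"
    by (subst sum.swap) (simp add: coeff_functional_def sum_distrib_right)
  finally show ?thesis .
qed

lemma sum_lessThan_mult:
  fixes F :: "nat \<Rightarrow> 'a :: comm_monoid_add"
  shows "(\<Sum>j<k * l. F j) = (\<Sum>p<k. \<Sum>q<l. F (p * l + q))"
  by (induction k) (simp_all add: sum_lessThan_add add.commute[of l])

text \<open>
  Every symmetric matrix with given antidiagonal sums is the Hankel matrix of their averages plus a
  symmetric matrix with vanishing antidiagonal sums, and the latter are parametrised linearly by the
  unknowns \<open>X p q\<close>.
\<close>

lemma lmi_describes_binary_form: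
  assumes a: "a \<le> n"
  shows "lmi_describes (Suc D) (forms n (2 * D))
    (\<lambda>f. \<forall>x y. 0 \<le> poly_eval f (vec n (two_valued a b x y)))"
proof -
  define k where "k = Suc D"
  then have k_pos: "0 < k" by simp
  define N where "N s = antidiag_sum k s (\<lambda>_ _. 1)" for s
  define L where "L \<alpha> r c = binary_coeff n a b (r + c) \<alpha> / N (r + c)" for \<alpha> r c
  \<comment> \<open>Coefficient of \<open>X p q\<close>: the symmetrised unit matrix at (p, q), with
    its antidiagonal total 2 spread evenly over the \<open>N\<close> cells and subtracted.\<close>
  define B' where "B' p q r c = (of_bool (p = r \<and> q = c) + of_bool (p = c \<and> q = r)
    - 2 * of_bool (p + q = r + c) / N (r + c) :: real)" for p q r c :: nat
  define B where "B j = B' (j div k) (j mod k)" for j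
  define C where "C f s = coeff_functional (binary_coeff n a b s) f" for f s
  have N_pos: "N s > 0" if "s \<le> 2 * D" for s
    unfolding N_def k_def using that by (rule antidiag_sum_one_pos)
  have B'_sum: "(\<Sum>p<k. \<Sum>q<k. X p q * B' p q r c) =
      X r c + X c r - 2 * antidiag_sum k (r + c) X / N (r + c)" if "r < k" "c < k" for X r c
  proof -
    have delta: "(\<Sum>p<k. \<Sum>q<k. X p q * of_bool (p = i \<and> q = j)) = X i j"
      if "i < k" "j < k" for i j
    proof -
      have "(\<Sum>p<k. \<Sum>q<k. X p q * of_bool (p = i \<and> q = j)) =
          (\<Sum>p<k. if p = i then (\<Sum>q<k. if q = j then X i j else 0) else 0)"
      proof (intro sum.cong refl)
        fix p
        show "(\<Sum>q<k. X p q * of_bool (p = i \<and> q = j)) =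
            (if p = i then (\<Sum>q<k. if q = j then X i j else 0) else 0)"
        proof (cases "p = i")
          case True
          show ?thesis unfolding True if_P[OF refl] by (intro sum.cong) auto
        qed simp
      qed
      then show ?thesis using that by simp
    qed
    have "(\<Sum>p<k. \<Sum>q<k. X p q * B' p q r c) =
        (\<Sum>p<k. \<Sum>q<k. X p q * of_bool (p = r \<and> q = c))
        + (\<Sum>p<k. \<Sum>q<k. X p q * of_bool (p = c \<and> q = r))
        - (\<Sum>p<k. \<Sum>q<k. 2 / N (r + c) * (if p + q = r + c then X p q else 0))"
      unfolding sum.distrib[symmetric] sum_subtractf[symmetric] B'_def
      by (intro sum.cong refl) (simp add: algebra_simps)
    also have "(\<Sum>p<k. \<Sum>q<k. 2 / N (r + c) * (if p + q = r + c then X p q else 0)) =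
        2 / N (r + c) * antidiag_sum k (r + c) X"
      by (simp only: antidiag_sum_def sum_distrib_left)
    finally show ?thesis unfolding delta[OF that] delta[OF that(2,1)] by simp
  qed
  have entry: "lmi_entry (k * k) L B f x r c = C f (r + c) / N (r + c)
      + (x (r * k + c) + x (c * k + r)
      - 2 * antidiag_sum k (r + c) (\<lambda>p q. x (p * k + q)) / N (r + c))"
    if "r < k" "c < k" for f x r c
  proof -
    have "(\<Sum>j<k * k. x j * B j r c) = (\<Sum>p<k. \<Sum>q<k. x (p * k + q) * B' p q r c)"
      unfolding sum_lessThan_mult B_def by (intro sum.cong refl) simp
    moreover have "coeff_functional (\<lambda>\<alpha>. L \<alpha> r c) f = C f (r + c) / N (r + c)"
      by (simp add: L_def C_def coeff_functional_def sum_divide_distrib)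
    ultimately show ?thesis
      unfolding lmi_entry_def using B'_sum[OF that, of "\<lambda>p q. x (p * k + q)"] by simp
  qed
  have "(\<forall>x y. 0 \<le> poly_eval f (vec n (two_valued a b x y))) \<longleftrightarrow>
      (\<exists>x. psd_kernel k (lmi_entry (k * k) L B f x))" if f: "f \<in> forms n (2 * D)" for f
  proof -
    have "(\<forall>x y. 0 \<le> poly_eval f (vec n (two_valued a b x y))) \<longleftrightarrow>
        (\<exists>Q. (\<forall>i j. Q i j = Q j i) \<and> psd_kernel k Q \<and>
          (\<forall>s\<le>2 * D. antidiag_sum k s Q = C f s))"
      unfolding poly_eval_two_valued[OF f a] C_def k_def by (rule nonneg_binary_form_iff)
    also have "\<dots> \<longleftrightarrow> (\<exists>x. psd_kernel k (lmi_entry (k * k) L B f x))"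
    proof
      assume "\<exists>Q. (\<forall>i j. Q i j = Q j i) \<and> psd_kernel k Q \<and>
          (\<forall>s\<le>2 * D. antidiag_sum k s Q = C f s)"
      then obtain Q where Q: "\<And>i j. Q i j = Q j i" "psd_kernel k Q"
        "\<And>s. s \<le> 2 * D \<Longrightarrow> antidiag_sum k s Q = C f s" by blast
      \<comment> \<open>The unknowns enter as X plus its transpose, hence the half.\<close>
      define x where "x j = (1 / 2) * Q (j div k) (j mod k)" for j
      have x: "x (p * k + q) = (1 / 2) * Q p q" if "q < k" for p q
        using that by (simp add: x_def)
      have antidiag_x: "2 * antidiag_sum k s (\<lambda>p q. x (p * k + q)) = C f s" if "s \<le> 2 * D" for s
      proof -
        have "antidiag_sum k s (\<lambda>p q. x (p * k + q)) = antidiag_sum k s (\<lambda>p q. (1 / 2) * Q p q)"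
          unfolding antidiag_sum_def by (intro sum.cong refl) (simp only: x lessThan_iff)
        also have "\<dots> = (1 / 2) * antidiag_sum k s Q" by (rule antidiag_sum_scale)
        finally show ?thesis using Q(3)[OF that] by simp
      qed
      have "lmi_entry (k * k) L B f x r c = Q r c" if "r < k" "c < k" for r c
      proof -
        have "r + c \<le> 2 * D" using that by (simp add: k_def)
        then show ?thesis
          unfolding entry[OF that] antidiag_x[OF \<open>r + c \<le> 2 * D\<close>] x[OF that(1)] x[OF that(2)]
          using Q(1)[of r c] by simp
      qed
      then have "psd_kernel k (lmi_entry (k * k) L B f x)"
        using Q(2) psd_kernel_cong[of k "lmi_entry (k * k) L B f x" Q] by blast
      then show "\<exists>x. psd_kernel k (lmi_entry (k * k) L B f x)" by blast
    next
      assume "\<exists>x. psd_kernel k (lmi_entry (k * k) L B f x)"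
      then obtain x where x: "psd_kernel k (lmi_entry (k * k) L B f x)" by blast
      define X where "X p q = x (p * k + q)" for p q
      \<comment> \<open>The Hankel part restores the prescribed antidiagonal sums for any choice of
        \<open>X\<close>.\<close>
      define h where "h s = C f s / N s + (- 2) * antidiag_sum k s X / N s" for s
      define Q where "Q r c = (X r c + X c r) + h (r + c)" for r c
      have "psd_kernel k Q"
        using x psd_kernel_cong[of k "lmi_entry (k * k) L B f x" Q]
        by (simp add: entry Q_def h_def X_def[symmetric])
      moreover have "Q i j = Q j i" for i j by (simp add: Q_def add.commute)
      moreover have "antidiag_sum k s Q = C f s" if "s \<le> 2 * D" for s
      proof -
        have "antidiag_sum k s Q = antidiag_sum k s X + antidiag_sum k s (\<lambda>r c. X c r)
            + antidiag_sum k s (\<lambda>r c. h (r + c))"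
          unfolding Q_def antidiag_sum_add ..
        also have "\<dots> = antidiag_sum k s X + antidiag_sum k s X + h s * N s"
          unfolding N_def by (simp only: antidiag_sum_transpose[of k s X] antidiag_sum_hankel[of k s h])
        also have "\<dots> = C f s" using N_pos[OF that] by (simp add: h_def field_simps)
        finally show ?thesis .
      qed
      ultimately show "\<exists>Q. (\<forall>i j. Q i j = Q j i) \<and> psd_kernel k Q \<and>
          (\<forall>s\<le>2 * D. antidiag_sum k s Q = C f s)" by blast
    qed
    finally show ?thesis .
  qed
  moreover have "L \<alpha> r c = L \<alpha> c r" for \<alpha> r c by (simp add: L_def add.commute)
  moreover have "B j r c = B j c r" for j r c
    by (simp add: B_def B'_def add.commute)
  ultimately show ?thesis unfolding lmi_describes_def k_def[symmetric] by blast
qed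

lemma lmi_describes_nonneg_two_valued:
  "lmi_describes ((n + 1)\<^sup>2 * Suc D) (forms n (2 * D)) (nonneg_two_valued n)"
proof -
  let ?I = "{..n} \<times> {..n}"
  have "lmi_describes (card ?I * Suc D) (forms n (2 * D))
      (\<lambda>f. \<forall>(a, b)\<in>?I. \<forall>x y. 0 \<le> poly_eval f (vec n (two_valued a b x y)))"
    by (rule lmi_describes_Ball) (auto intro: lmi_describes_binary_form)
  also have "(\<lambda>f. \<forall>(a, b)\<in>?I. \<forall>x y. 0 \<le> poly_eval f (vec n (two_valued a b x y))) =
      nonneg_two_valued n"
    by (auto simp: nonneg_two_valued_def fun_eq_iff)
  finally show ?thesis by (simp add: power2_eq_square)
qed

lemma nonneg_poly_imp_two_valued: "nonneg_poly n f \<Longrightarrow> nonneg_two_valued n f"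
  by (simp add: nonneg_poly_def nonneg_two_valued_def)

theorem theorem4p29:
  fixes G :: "nat \<Rightarrow> (real vec \<Rightarrow> real vec) set" and d :: nat
  assumes "(G, d) \<in> {(coord_perms, 4), (signed_coord_perms, 6),
                      (signed_coord_perms, 8), (signed_coord_perms, 10)}"
  shows "(\<forall>n. spectrahedral_shadow (nonneg_cone (G n) n d)) \<and>
         (\<exists>s :: nat \<Rightarrow> nat. (\<lambda>n. real (s n)) \<in> O(\<lambda>n. real n ^ 3) \<and>
            (\<forall>n. lmi_certifiable (s n) n (invariant_forms (G n) n d)))"
proof -
  obtain D where D: "d = 2 * D"
    using assms by (auto simp: intro: that[of 2] that[of 3] that[of 4] that[of 5])
  \<comment> \<open>The bound 5 covers degree 4, and the bound 11 covers degrees 6, 8 and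
    10.\<close>
  have nonneg: "nonneg_two_valued n f \<longleftrightarrow> nonneg_poly n f" if "f \<in> invariant_forms (G n) n d" for n f
    using assms that nonneg_poly_imp_two_valued[of n f] half_degree_symmetric[of f n d]
      half_degree_signed_symmetric[of f n d] by auto
  \<comment> \<open>One block of size D + 1 for each pair (a, b). The size is quadratic in n, hence
    within the cubic bound.\<close>
  define s where "s n = (n + 1)\<^sup>2 * Suc D" for n
  have sub: "invariant_forms (G n) n d \<subseteq> forms n d" for n by (auto simp: invariant_forms_def)
  have describes: "lmi_describes (s n) (invariant_forms (G n) n d) (nonneg_poly n)" for n
    using lmi_describes_subset[OF lmi_describes_nonneg_two_valued sub[of n, unfolded D], folded D]
      lmi_describes_cong[OF nonneg] by (simp add: s_def)
  have "spectrahedral_shadow (nonneg_cone (G n) n d)" for n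
    unfolding nonneg_cone_def
    by (rule spectrahedral_shadow_if_describes[OF sub zero_in_invariant_forms add_in_invariant_forms
          poly_scale_in_invariant_forms describes])
  moreover have "(\<lambda>n. real (s n)) \<in> O(\<lambda>n. real n ^ 3)"
  proof (rule bigoI)
    show "eventually (\<lambda>n. norm (real (s n)) \<le> (4 * real (Suc D)) * norm (real n ^ 3)) at_top"
      using eventually_ge_at_top[of 1]
    proof eventually_elim
      case (elim n)
      have "(n + 1)\<^sup>2 \<le> (2 * n)\<^sup>2" using elim by (intro power_mono) auto
      also have "\<dots> \<le> 4 * n ^ 3"
        using elim by (simp add: power2_eq_square power3_eq_cube)
      finally have "s n \<le> (4 * n ^ 3) * Suc D" unfolding s_def by (rule mult_right_mono) simp
      then have "real (s n) \<le> real ((4 * n ^ 3) * Suc D)" by (rule of_nat_mono)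
      then show ?case by (simp add: algebra_simps)
    qed
  qed
  ultimately show ?thesis using lmi_certifiable_if_describes[OF describes] by blast
qed

end
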